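(* Let $(G,X)$ be a flow, where $G$ is compactly generated with compact generating set $\Gamma$, and $X$ is $0$-dimensional. Then the following properties are pairwise equivalent (and this holds for either reading of (1), i.e. with $\Gamma$-recurrence of type I as well as with $\Gamma$-recurrence of type II): (1) $(G,X)$ is pointwise recurrent, i.e. every $x\in X$ is $\Gamma$-recurrent of type I (respectively: every $x\in X$ is $\Gamma$-recurrent of type II). (2) $(G,X)$ is pointwise almost periodic. (3) $X$ is a union of minimal sets. (4) The orbit closure relation $R_o(X)=\{(x,y)\in X\times X : y\in\overline{Gx}\}$ is closed in $X\times X$. (5) The orbit closure mapping $\mathscr{O}_G\colon X\to 2^X$, $x\mapsto\overline{Gx}$, is $\ulcorner$continuous$\urcorner$ on $X$. (6) The orbit closure mapping $\mathscr{O}_G$ is continuous on $X$. (7) $(G,X)$ is locally weakly almost periodic.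
   Context: A Hausdorff para-topological group is a group with a Hausdorff topology for which multiplication $G\times G\to G$ is jointly continuous (inversion need not be continuous). A flow $(G,X)$ consists of a Hausdorff para-topological group $G$, a locally compact Hausdorff uniform space $X$ (uniformity $\mathscr{U}$), and a jointly continuous map $G\times X\to X$, $(t,x)\mapsto tx$, with $ex=x$ and $(st)x=s(tx)$, such that $\overline{Gx}$ is compact for every $x\in X$ (Lagrange stability). $\mathfrak{N}_x$ is the neighborhood filter of $x$; $N_G(x,U)=\{t\in G: tx\in U\}$; $\alpha[x]=\{y:(x,y)\in\alpha\}$. A Hausdorff space is $0$-dimensional if it has a base of clopen sets. $G$ is compactly generated if there is a compact $\Gamma\subseteq G$ (a generating set) with $e\in\Gamma=\Gamma^{-1}$ and $G=\bigcup_{r\ge1}\Gamma^r$. Limits of sets: for a Hausdorff space $Y$, $2^Y$ is the collection of closed subsets. For a net $\{Y_i\}$ in $2^Y$, write $Y_i\rightharpoonup K$ if $K$ is the set of all $y\in Y$ for which there are a subnet $\{Y_{i_k}\}$ and $y_{i_k}\in Y_{i_k}$ with $y_{i_k}\to y$. Recurrence: for $g\ne e$ in $G$, $|g|$ is the least $r$ with $g\in\Gamma^r$, and $\boldsymbol{K}(g)=\Gamma^{|g|-1}g$ with $\Gamma^0=\{e\}$. A $\Gamma$-cone is a set $\boldsymbol{C}\subseteq G$ such that $\boldsymbol{K}(g_i)\rightharpoonup\boldsymbol{C}$ in $2^G$ for some net $\{g_i\}$ in $G\setminus\{e\}$ with $|g_i|\nearrow\infty$ (i.e. $|g_i|\to\infty$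 and $i\le i'$ implies $|g_i|\le|g_{i'}|$). A point $x$ is $\Gamma$-recurrent of type I if $\boldsymbol{C}x\cap U\ne\emptyset$ for every $\Gamma$-cone $\boldsymbol{C}$ and every $U\in\mathfrak{N}_x$. A point $x$ is $\Gamma$-recurrent of type II if for every $U\in\mathfrak{N}_x$ and every net $\{g_i\}$ in $G\setminus\{e\}$ with $|g_i|\to\infty$ there are an integer $n\ge1$, a subnet $\{g_{i_j}\}$ and $c_j\in\boldsymbol{K}(g_{i_j})$ with $c_jx\in U$ and $|c_j|\le n$. Almost periodicity: $A\subseteq G$ is syndetic if $G=K^{-1}A$ for some compact $K\subseteq G$. A point $x$ is almost periodic if $N_G(x,U)$ is syndetic for all $U\in\mathfrak{N}_x$; $(G,X)$ is pointwise almost periodic if all points are. A set $K\subseteq X$ is minimal if $\overline{Gx}=K$ for all $x\in K$. $(G,X)$ is locally weakly almost periodic if for every $\alpha\in\mathscr{U}$ and $x\in X$ there are a compact $F\subseteq G$ and $V\in\mathfrak{N}_x$ with $Fty\cap\alpha[y]\neq\emptyset$ for all $y\in V$, $t\in G$. $\mathscr{O}_G$ is $\ulcorner$continuous$\urcorner$ if $x_i\to x$ in $X$ implies $\overline{Gx_i}\rightharpoonup\overline{Gx}$ in $2^X$. $\mathscr{O}_G$ is continuous if $x_i\to x$ implies $\overline{Gx_i}\to\overline{Gx}$ in $2^X$ with the Hausdorff topology (the topology of the Hausdorff uniformity: for every $\alpha\in\mathscr{U}$, eventually $\overline{Gx_i}\subseteq\alpha[\overline{Gx}]$ and $\overline{Gx}\subseteq\alpha[\overline{Gx_i}]$).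 *)

theory Defs
  imports "HOL-Analysis.Analysis" "HOL-Library.Set_Algebras"
begin

section \<open>Nets\<close>

text \<open>
  A directed set is given by its order relation \<open>r\<close>: the carrier is \<open>Field r\<close>, and
  \<open>(i, j) \<in> r\<close> means \<open>i \<le> j\<close>. A net is a function on the index type, of which only the
  values on \<open>Field r\<close> matter.
\<close>

definition directed :: "'i rel \<Rightarrow> bool" where
  "directed r \<longleftrightarrow> r \<noteq> {} \<and> preorder_on (Field r) r \<and>
     (\<forall>i\<in>Field r. \<forall>j\<in>Field r. \<exists>k. (i, k) \<in> r \<and> (j, k) \<in> r)"

definition net_filter :: "'i rel \<Rightarrow> 'i filter" where
  "net_filter r = (INF i\<in>Field r. principal (r `` {i}))"

lemma directed_nonempty:
  assumes "directed r"
  obtains i where "i \<in> Field r"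
proof -
  have "r \<noteq> {}"
    using assms by (simp only: directed_def simp_thms)
  then obtain p where "p \<in> r" by blast
  then have "(fst p, snd p) \<in> r" by simp
  then have "fst p \<in> Field r" by (rule FieldI1)
  then show ?thesis by (rule that)
qed

lemma directed_upper_bound:
  assumes "directed r" "i \<in> Field r" "j \<in> Field r"
  obtains k where "(i, k) \<in> r" "(j, k) \<in> r"
  using assms by (metis directed_def)

lemma directed_refl: "directed r \<Longrightarrow> i \<in> Field r \<Longrightarrow> (i, i) \<in> r"
  by (simp only: directed_def preorder_on_def refl_on_def)

lemma directed_trans: "directed r \<Longrightarrow> (i, j) \<in> r \<Longrightarrow> (j, k) \<in> r \<Longrightarrow> (i, k) \<in> r"
  by (metis directed_def preorder_on_def transD)

lemma directed_tail_mono: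
  assumes "directed r" "(i, j) \<in> r"
  shows "r `` {j} \<subseteq> r `` {i}"
proof
  fix k assume "k \<in> r `` {j}"
  then have "(j, k) \<in> r" by simp
  with assms have "(i, k) \<in> r" by (rule directed_trans)
  then show "k \<in> r `` {i}" by simp
qed

lemma eventually_net_filter:
  assumes "directed r"
  shows "eventually P (net_filter r) \<longleftrightarrow> (\<exists>i\<in>Field r. \<forall>j. (i, j) \<in> r \<longrightarrow> P j)"
proof -
  have "Field r \<noteq> {}"
    using directed_nonempty[OF assms] by blast
  moreover have "\<exists>k\<in>Field r. principal (r `` {k}) \<le> inf (principal (r `` {i})) (principal (r `` {j}))"
    if ij: "i \<in> Field r" "j \<in> Field r" for i j
  proof -
    obtain k where "(i, k) \<in> r" "(j, k) \<in> r"
      using directed_upper_bound[OF assms ij] .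
    moreover from this have "r `` {k} \<subseteq> r `` {i} \<inter> r `` {j}"
      by (intro Int_greatest directed_tail_mono[OF assms])
    moreover have "k \<in> Field r"
      using \<open>(i, k) \<in> r\<close> by (rule FieldI2)
    ultimately show ?thesis
      by (simp only: inf_principal principal_le_iff) (rule bexI)
  qed
  ultimately have "eventually P (net_filter r) \<longleftrightarrow> (\<exists>i\<in>Field r. eventually P (principal (r `` {i})))"
    unfolding net_filter_def by (rule eventually_INF_base)
  then show ?thesis
    unfolding eventually_principal by blast
qed

lemma frequently_net_filter:
  assumes "directed r"
  shows "frequently P (net_filter r) \<longleftrightarrow> (\<forall>i\<in>Field r. \<exists>j. (i, j) \<in> r \<and> P j)"
  unfolding frequently_def eventually_net_filter[OF assms] by blast

definition subnet :: "'i rel \<Rightarrow> 'k rel \<Rightarrow> ('k \<Rightarrow> 'i) \<Rightarrow> bool" where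
  "subnet r s h \<longleftrightarrow> directed s \<and> h ` Field s \<subseteq> Field r \<and>
     (\<forall>i\<in>Field r. \<exists>k\<in>Field s. \<forall>l. (k, l) \<in> s \<longrightarrow> (i, h l) \<in> r)"

text \<open>
  Quantifiers over nets must fix an index type. Nets in a type \<open>'a\<close> are indexed by
  \<open>'a set \<times> 'a\<close> below. This is no restriction: the following lemma replaces a net over an
  arbitrary index type by one over \<open>'a set \<times> 'a\<close> that takes values of the given net and has
  the same tail filter. Moreover, if a natural-number-valued rank is, from some index on, at least
  the rank of any given member of the net, then the new net can be chosen with monotone rank.
\<close>

lemma canonical_net:
  fixes x :: "'i \<Rightarrow> 'a" and \<phi> :: "'a \<Rightarrow> nat"
  assumes "directed r"
    and rank: "\<And>i. i \<in> Field r \<Longrightarrow> eventually (\<lambda>j. \<phi> (x i) \<le> \<phi> (x j)) (net_filter r)"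
  obtains s :: "('a set \<times> 'a) rel" where "directed s" "snd ` Field s \<subseteq> x ` Field r"
    "filtermap snd (net_filter s) = filtermap x (net_filter r)"
    "\<And>k l. (k, l) \<in> s \<Longrightarrow> \<phi> (snd k) \<le> \<phi> (snd l)"
proof -
  define T where "T i = x ` (r `` {i})" for i
  define D where "D = {(T i, a) |i a. i \<in> Field r \<and> a \<in> T i}"
  define s where "s = {(k, l). k \<in> D \<and> l \<in> D \<and> fst l \<subseteq> fst k \<and> \<phi> (snd k) \<le> \<phi> (snd l)}"
  have Field_s: "Field s = D"
  proof
    show "Field s \<subseteq> D"
      by (auto simp: s_def Field_def)
    show "D \<subseteq> Field s"
      by (auto simp: s_def intro: FieldI1)
  qed
  have memD: "(T i, x j) \<in> D" if "(i, j) \<in> r" for i j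
    using that unfolding D_def T_def by (blast intro: FieldI1)
  have "directed s"
    unfolding directed_def
  proof (intro conjI ballI)
    obtain i where "i \<in> Field r"
      using directed_nonempty[OF \<open>directed r\<close>] .
    then have "(i, i) \<in> r"
      by (rule directed_refl[OF \<open>directed r\<close>])
    then have "((T i, x i), (T i, x i)) \<in> s"
      using memD unfolding s_def by auto
    then show "s \<noteq> {}" by auto
    show "preorder_on (Field s) s"
      unfolding preorder_on_def Field_s
    proof (intro conjI)
      show "s \<subseteq> D \<times> D" by (auto simp: s_def)
      show "refl_on D s" by (auto simp: refl_on_def s_def)
      show "trans s" by (rule transI) (force simp: s_def)
    qed
  next
    fix k l assume "k \<in> Field s" "l \<in> Field s"
    then have "k \<in> D" "l \<in> D" by (auto simp: Field_s)
    then obtain i i' a a' where i: "k = (T i, x a)" "(i, a) \<in> r" and i': "l = (T i', x a')" "(i', a') \<in> r"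
      unfolding D_def T_def by blast
    have F: "i \<in> Field r" "i' \<in> Field r" "a \<in> Field r" "a' \<in> Field r"
      using i i' by (blast intro: FieldI1 FieldI2)+
    have "eventually (\<lambda>j. (i, j) \<in> r) (net_filter r)" "eventually (\<lambda>j. (i', j) \<in> r) (net_filter r)"
      using F by (auto simp: eventually_net_filter[OF \<open>directed r\<close>])
    with rank[OF F(3)] rank[OF F(4)]
    have "eventually (\<lambda>j. (i, j) \<in> r \<and> (i', j) \<in> r \<and> \<phi> (x a) \<le> \<phi> (x j) \<and> \<phi> (x a') \<le> \<phi> (x j)) (net_filter r)"
      by eventually_elim auto
    then obtain j where j: "j \<in> Field r" "(i, j) \<in> r" "(i', j) \<in> r" "\<phi> (x a) \<le> \<phi> (x j)" "\<phi> (x a') \<le> \<phi> (x j)"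
      unfolding eventually_net_filter[OF \<open>directed r\<close>] using directed_refl[OF \<open>directed r\<close>] by blast
    have "T j \<subseteq> T i" "T j \<subseteq> T i'"
      unfolding T_def by (intro image_mono directed_tail_mono[OF \<open>directed r\<close>] j)+
    moreover have "(T j, x j) \<in> D"
      by (intro memD directed_refl[OF \<open>directed r\<close>] j)
    ultimately have "(k, (T j, x j)) \<in> s" "(l, (T j, x j)) \<in> s"
      using i i' j \<open>k \<in> D\<close> \<open>l \<in> D\<close> unfolding s_def by auto
    then show "\<exists>m. (k, m) \<in> s \<and> (l, m) \<in> s" by blast
  qed
  moreover have "snd ` Field s \<subseteq> x ` Field r"
    unfolding Field_s D_def T_def by (auto intro: FieldI2)
  moreover have "filtermap snd (net_filter s) = filtermap x (net_filter r)"
  proof -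
    have "(\<exists>k\<in>Field s. \<forall>l. (k, l) \<in> s \<longrightarrow> P (snd l)) \<longleftrightarrow> (\<exists>i\<in>Field r. \<forall>j. (i, j) \<in> r \<longrightarrow> P (x j))" for P
    proof
      assume "\<exists>k\<in>Field s. \<forall>l. (k, l) \<in> s \<longrightarrow> P (snd l)"
      then obtain k where k: "k \<in> D" "\<And>l. (k, l) \<in> s \<Longrightarrow> P (snd l)"
        unfolding Field_s by blast
      then obtain i a where i: "k = (T i, x a)" "(i, a) \<in> r"
        unfolding D_def T_def by blast
      have F: "i \<in> Field r" "a \<in> Field r"
        using i by (blast intro: FieldI1 FieldI2)+
      have "eventually (\<lambda>j. (i, j) \<in> r) (net_filter r)"
        using F by (auto simp: eventually_net_filter[OF \<open>directed r\<close>])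
      with rank[OF F(2)] have "eventually (\<lambda>j. P (x j)) (net_filter r)"
      proof eventually_elim
        case (elim j)
        then have "(k, (T i, x j)) \<in> s"
          using memD i k unfolding s_def by auto
        then show ?case using k(2) by fastforce
      qed
      then show "\<exists>i\<in>Field r. \<forall>j. (i, j) \<in> r \<longrightarrow> P (x j)"
        by (simp add: eventually_net_filter[OF \<open>directed r\<close>])
    next
      assume "\<exists>i\<in>Field r. \<forall>j. (i, j) \<in> r \<longrightarrow> P (x j)"
      then obtain i where i: "i \<in> Field r" "\<And>j. (i, j) \<in> r \<Longrightarrow> P (x j)" by blast
      then have "(T i, x i) \<in> Field s"
        unfolding Field_s by (intro memD directed_refl[OF \<open>directed r\<close>])
      moreover have "P (snd l)" if "((T i, x i), l) \<in> s" for l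
      proof -
        have "fst l \<subseteq> T i" "snd l \<in> fst l"
          using that unfolding s_def D_def by auto
        then have "snd l \<in> x ` (r `` {i})"
          unfolding T_def by blast
        then show ?thesis using i(2) by auto
      qed
      ultimately show "\<exists>k\<in>Field s. \<forall>l. (k, l) \<in> s \<longrightarrow> P (snd l)" by blast
    qed
    then show ?thesis
      by (simp add: filter_eq_iff eventually_filtermap eventually_net_filter[OF \<open>directed s\<close>]
          eventually_net_filter[OF \<open>directed r\<close>])
  qed
  moreover have "\<phi> (snd k) \<le> \<phi> (snd l)" if "(k, l) \<in> s" for k l
    using that unfolding s_def by auto
  ultimately show ?thesis by (rule that)
qed


section \<open>Limits of nets of closed sets\<close>

definition upper_limit :: "'i rel \<Rightarrow> ('i \<Rightarrow> 'y::topological_space set) \<Rightarrow> 'y set" where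
  "upper_limit r Y = {y. \<exists>(s :: ('i \<times> 'y set) rel) h z.
     subnet r s h \<and> (\<forall>k\<in>Field s. z k \<in> Y (h k)) \<and> (z \<longlongrightarrow> y) (net_filter s)}"


text \<open>The index type used for these subnets is no restriction either.\<close>

lemma cluster_subnet:
  fixes Y :: "'i \<Rightarrow> 'y::topological_space set" and s :: "'k rel"
  assumes "directed r" "subnet r s h" "\<And>k. k \<in> Field s \<Longrightarrow> z k \<in> Y (h k)"
    and "(z \<longlongrightarrow> y) (net_filter s)" "open U" "y \<in> U"
  shows "frequently (\<lambda>i. Y i \<inter> U \<noteq> {}) (net_filter r)"
  unfolding frequently_net_filter[OF \<open>directed r\<close>]
proof
  fix i assume "i \<in> Field r"
  have "directed s" using assms(2) by (simp add: subnet_def)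
  obtain k where k: "k \<in> Field s" "\<And>l. (k, l) \<in> s \<Longrightarrow> (i, h l) \<in> r"
    using assms(2) \<open>i \<in> Field r\<close> unfolding subnet_def by blast
  have "eventually (\<lambda>l. z l \<in> U) (net_filter s)"
    using assms(4-6) by (simp add: topological_tendstoD)
  then obtain k' where k': "k' \<in> Field s" "\<And>l. (k', l) \<in> s \<Longrightarrow> z l \<in> U"
    unfolding eventually_net_filter[OF \<open>directed s\<close>] by blast
  obtain l where l: "(k, l) \<in> s" "(k', l) \<in> s"
    using directed_upper_bound[OF \<open>directed s\<close> k(1) k'(1)] .
  then have "l \<in> Field s" by (blast intro: FieldI2)
  then show "\<exists>j. (i, j) \<in> r \<and> Y j \<inter> U \<noteq> {}"
    using k(2) k'(2) l assms(3) by blast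
qed

lemma mem_upper_limit_iff:
  assumes "directed r"
  shows "y \<in> upper_limit r Y \<longleftrightarrow>
    (\<forall>U. open U \<longrightarrow> y \<in> U \<longrightarrow> frequently (\<lambda>i. Y i \<inter> U \<noteq> {}) (net_filter r))" (is "_ \<longleftrightarrow> ?R")
proof
  assume "y \<in> upper_limit r Y"
  then show ?R
    unfolding upper_limit_def using cluster_subnet[OF assms] by blast
next
  assume R: ?R
  define D where "D = {(i, U). i \<in> Field r \<and> open U \<and> y \<in> U \<and> Y i \<inter> U \<noteq> {}}"
  define s where "s = {(k, l). k \<in> D \<and> l \<in> D \<and> (fst k, fst l) \<in> r \<and> snd l \<subseteq> snd k}"
  define z where "z k = (SOME w. w \<in> Y (fst k) \<inter> snd k)" for k
  have Field_s: "Field s = D"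
  proof
    show "Field s \<subseteq> D"
      by (auto simp: s_def Field_def)
    show "D \<subseteq> Field s"
    proof
      fix k assume "k \<in> D"
      then have "(k, k) \<in> s"
        using directed_refl[OF assms, of "fst k"] by (auto simp: s_def D_def)
      then show "k \<in> Field s" by (rule FieldI1)
    qed
  qed
  have z: "z k \<in> Y (fst k) \<inter> snd k" if "k \<in> D" for k
    unfolding z_def by (rule someI_ex) (use that in \<open>auto simp: D_def\<close>)
  have ex: "\<exists>j. (i, j) \<in> r \<and> (j, U) \<in> D" if iU: "i \<in> Field r" "open U" "y \<in> U" for i U
  proof -
    have "frequently (\<lambda>i. Y i \<inter> U \<noteq> {}) (net_filter r)"
      using R iU(2,3) by simp
    then obtain j where j: "(i, j) \<in> r" "Y j \<inter> U \<noteq> {}"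
      using iU(1) unfolding frequently_net_filter[OF assms] by blast
    from j(1) have "j \<in> Field r" by (rule FieldI2)
    with j iU show ?thesis unfolding D_def by blast
  qed
  obtain i0 where i0: "i0 \<in> Field r"
    using directed_nonempty[OF assms] .
  have "directed s"
    unfolding directed_def
  proof (intro conjI ballI)
    have "D \<noteq> {}" using ex[OF i0, of UNIV] by auto
    then show "s \<noteq> {}" unfolding Field_s[symmetric] by auto
    show "preorder_on (Field s) s"
      unfolding preorder_on_def Field_s
    proof (intro conjI)
      show "s \<subseteq> D \<times> D" by (auto simp: s_def)
      show "refl_on D s"
        unfolding refl_on_def
      proof
        fix k assume "k \<in> D"
        then show "(k, k) \<in> s"
          using directed_refl[OF assms, of "fst k"] by (auto simp: s_def D_def)
      qed
      show "trans s"
      proof (rule transI)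
        fix k l m assume kl: "(k, l) \<in> s" and lm: "(l, m) \<in> s"
        have "(fst k, fst l) \<in> r" "(fst l, fst m) \<in> r"
          using kl lm unfolding s_def by simp_all
        then have "(fst k, fst m) \<in> r"
          by (rule directed_trans[OF assms])
        moreover have "k \<in> D" "m \<in> D" "snd m \<subseteq> snd k"
          using kl lm unfolding s_def by auto
        ultimately show "(k, m) \<in> s" unfolding s_def by simp
      qed
    qed
  next
    fix k l assume "k \<in> Field s" "l \<in> Field s"
    then have kl: "k \<in> D" "l \<in> D" by (auto simp: Field_s)
    then have "fst k \<in> Field r" "fst l \<in> Field r" by (auto simp: D_def)
    then obtain i where i: "(fst k, i) \<in> r" "(fst l, i) \<in> r"
      using directed_upper_bound[OF assms] by blast
    from i(1) have "i \<in> Field r" by (rule FieldI2)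
    moreover have "open (snd k \<inter> snd l)" "y \<in> snd k \<inter> snd l"
      using kl by (auto simp: D_def)
    ultimately obtain j where j: "(i, j) \<in> r" "(j, snd k \<inter> snd l) \<in> D"
      using ex[of i "snd k \<inter> snd l"] by blast
    have "(fst k, j) \<in> r" "(fst l, j) \<in> r"
      by (rule directed_trans[OF assms i(1) j(1)], rule directed_trans[OF assms i(2) j(1)])
    then have "(k, (j, snd k \<inter> snd l)) \<in> s" "(l, (j, snd k \<inter> snd l)) \<in> s"
      using j(2) kl by (auto simp: s_def)
    then show "\<exists>m. (k, m) \<in> s \<and> (l, m) \<in> s" by blast
  qed
  moreover have "subnet r s fst"
    unfolding subnet_def
  proof (intro conjI ballI)
    show "fst ` Field s \<subseteq> Field r" by (auto simp: Field_s D_def)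
  next
    fix i assume "i \<in> Field r"
    then obtain j where j: "(i, j) \<in> r" "(j, UNIV) \<in> D" using ex[of i UNIV] by auto
    have "\<forall>l. ((j, UNIV), l) \<in> s \<longrightarrow> (i, fst l) \<in> r"
      using directed_trans[OF assms j(1)] unfolding s_def by simp
    then show "\<exists>k\<in>Field s. \<forall>l. (k, l) \<in> s \<longrightarrow> (i, fst l) \<in> r"
      using j(2) unfolding Field_s by blast
  qed fact
  moreover have "(z \<longlongrightarrow> y) (net_filter s)"
  proof (rule topological_tendstoI)
    fix U assume U: "open U" "y \<in> U"
    then obtain j where j: "(j, U) \<in> D" using ex[OF i0 U] by blast
    have "z l \<in> U" if "((j, U), l) \<in> s" for l
      using that z[of l] unfolding s_def by auto
    then show "eventually (\<lambda>l. z l \<in> U) (net_filter s)"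
      using j unfolding eventually_net_filter[OF \<open>directed s\<close>] Field_s by blast
  qed
  moreover have "\<forall>k\<in>Field s. z k \<in> Y (fst k)"
    using z by (auto simp: Field_s)
  ultimately show "y \<in> upper_limit r Y"
    unfolding upper_limit_def by blast
qed

lemma eventually_reindex:
  assumes "filtermap u (net_filter s) = filtermap x (net_filter r)"
  shows "eventually (\<lambda>k. P (u k)) (net_filter s) \<longleftrightarrow> eventually (\<lambda>i. P (x i)) (net_filter r)"
  using arg_cong[OF assms, of "eventually P"] by (simp only: eventually_filtermap)

lemma upper_limit_reindex:
  assumes "directed r" "directed s" "filtermap u (net_filter s) = filtermap x (net_filter r)"
  shows "upper_limit s (\<lambda>k. Y (u k)) = upper_limit r (\<lambda>i. Y (x i))"
proof -
  have "frequently (\<lambda>k. Y (u k) \<inter> U \<noteq> {}) (net_filter s) \<longleftrightarrow>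
        frequently (\<lambda>i. Y (x i) \<inter> U \<noteq> {}) (net_filter r)" for U
    unfolding frequently_def using eventually_reindex[OF assms(3), of "\<lambda>a. \<not> Y a \<inter> U \<noteq> {}"] by simp
  then show ?thesis
    by (simp add: set_eq_iff mem_upper_limit_iff[OF assms(1)] mem_upper_limit_iff[OF assms(2)])
qed

definition tends_to_set :: "'i rel \<Rightarrow> ('i \<Rightarrow> 'y::topological_space set) \<Rightarrow> 'y set \<Rightarrow> bool" where
  "tends_to_set r Y K \<longleftrightarrow> (\<forall>i\<in>Field r. closed (Y i)) \<and> closed K \<and> K = upper_limit r Y"

definition tends_to_Hausdorff :: "'i rel \<Rightarrow> ('i \<Rightarrow> 'y::uniform_space set) \<Rightarrow> 'y set \<Rightarrow> bool" where
  "tends_to_Hausdorff r Y K \<longleftrightarrow> (\<forall>i\<in>Field r. closed (Y i)) \<and> closed K \<and>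
     (\<forall>\<alpha>. eventually (\<lambda>p. p \<in> \<alpha>) uniformity \<longrightarrow>
        eventually (\<lambda>i. Y i \<subseteq> \<alpha> `` K \<and> K \<subseteq> \<alpha> `` Y i) (net_filter r))"

definition zero_dimensional :: "'a::topological_space itself \<Rightarrow> bool" where
  "zero_dimensional _ \<longleftrightarrow>
     (\<exists>B :: 'a set set. topological_basis B \<and> (\<forall>b\<in>B. open b \<and> closed b))"

definition nbhds_of :: "'a::topological_space \<Rightarrow> 'a set set" where
  "nbhds_of x = {U. eventually (\<lambda>y. y \<in> U) (nhds x)}"


section \<open>Flows\<close>

text \<open>
  The acting group is written additively: the sort
  \<open>{group_add, topological_monoid_add, t2_space}\<close> consists of the (not necessarily
  commutative) groups with a Hausdorff topology for which the group operation is jointly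
  continuous, whereas nothing is assumed about the continuity of inversion.
\<close>

definition orbit :: "('g \<Rightarrow> 'x \<Rightarrow> 'x) \<Rightarrow> 'x \<Rightarrow> 'x set" where
  "orbit act x = range (\<lambda>t. act t x)"

definition flow ::
  "('g::{group_add, topological_monoid_add, t2_space} \<Rightarrow> 'x::{uniform_space, t2_space} \<Rightarrow> 'x) \<Rightarrow> bool"
where
  "flow act \<longleftrightarrow>
     locally_compact_space (euclidean :: 'x topology) \<and>
     continuous_on UNIV (\<lambda>(t, x). act t x) \<and>
     (\<forall>x. act 0 x = x) \<and>
     (\<forall>s t x. act (s + t) x = act s (act t x)) \<and>
     (\<forall>x. compact (closure (orbit act x)))"

definition syndetic :: "'g::{group_add, topological_space} set \<Rightarrow> bool" where
  "syndetic A \<longleftrightarrow> (\<exists>K. compact K \<and> UNIV = uminus ` K + A)"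

definition almost_periodic ::
  "('g::{group_add, topological_space} \<Rightarrow> 'x::topological_space \<Rightarrow> 'x) \<Rightarrow> 'x \<Rightarrow> bool" where
  "almost_periodic act x \<longleftrightarrow> (\<forall>U\<in>nbhds_of x. syndetic {t. act t x \<in> U})"

definition minimal_set :: "('g \<Rightarrow> 'x::topological_space \<Rightarrow> 'x) \<Rightarrow> 'x set \<Rightarrow> bool" where
  "minimal_set act K \<longleftrightarrow> (\<forall>x\<in>K. closure (orbit act x) = K)"

definition locally_weakly_almost_periodic ::
  "('g::topological_space \<Rightarrow> 'x::uniform_space \<Rightarrow> 'x) \<Rightarrow> bool" where
  "locally_weakly_almost_periodic act \<longleftrightarrow>
     (\<forall>\<alpha> x. eventually (\<lambda>p. p \<in> \<alpha>) uniformity \<longrightarrow>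
        (\<exists>F. compact F \<and> (\<exists>V\<in>nbhds_of x. \<forall>y\<in>V. \<forall>t.
           (\<lambda>f. act f (act t y)) ` F \<inter> \<alpha> `` {y} \<noteq> {})))"

definition orbit_closure_relation :: "('g \<Rightarrow> 'x::topological_space \<Rightarrow> 'x) \<Rightarrow> ('x \<times> 'x) set" where
  "orbit_closure_relation act = {(x, y). y \<in> closure (orbit act x)}"

definition orbit_closure_map_upper_limit_continuous ::
  "('g \<Rightarrow> 'x::topological_space \<Rightarrow> 'x) \<Rightarrow> bool" where
  "orbit_closure_map_upper_limit_continuous act \<longleftrightarrow>
     (\<forall>(r :: ('x set \<times> 'x) rel) xs x. directed r \<longrightarrow> (xs \<longlongrightarrow> x) (net_filter r) \<longrightarrow>
        tends_to_set r (\<lambda>i. closure (orbit act (xs i))) (closure (orbit act x)))"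

definition orbit_closure_map_Hausdorff_continuous ::
  "('g \<Rightarrow> 'x::uniform_space \<Rightarrow> 'x) \<Rightarrow> bool" where
  "orbit_closure_map_Hausdorff_continuous act \<longleftrightarrow>
     (\<forall>(r :: ('x set \<times> 'x) rel) xs x. directed r \<longrightarrow> (xs \<longlongrightarrow> x) (net_filter r) \<longrightarrow>
        tends_to_Hausdorff r (\<lambda>i. closure (orbit act (xs i))) (closure (orbit act x)))"


section \<open>Recurrence\<close>

fun set_pow :: "'g::monoid_add set \<Rightarrow> nat \<Rightarrow> 'g set" where
  "set_pow \<Gamma> 0 = {0}"
| "set_pow \<Gamma> (Suc r) = set_pow \<Gamma> r + \<Gamma>"

definition compact_generating_set :: "'g::{group_add, topological_space} set \<Rightarrow> bool" where
  "compact_generating_set \<Gamma> \<longleftrightarrow>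
     compact \<Gamma> \<and> 0 \<in> \<Gamma> \<and> \<Gamma> = uminus ` \<Gamma> \<and> UNIV = (\<Union>r\<in>{1..}. set_pow \<Gamma> r)"

definition word_len :: "'g::monoid_add set \<Rightarrow> 'g \<Rightarrow> nat" where
  "word_len \<Gamma> g = (LEAST r. g \<in> set_pow \<Gamma> r)"

definition K_set :: "'g::monoid_add set \<Rightarrow> 'g \<Rightarrow> 'g set" where
  "K_set \<Gamma> g = (\<lambda>h. h + g) ` set_pow \<Gamma> (word_len \<Gamma> g - 1)"

definition gamma_cone :: "'g::{monoid_add, topological_space} set \<Rightarrow> 'g set \<Rightarrow> bool" where
  "gamma_cone \<Gamma> C \<longleftrightarrow> (\<exists>(r :: ('g set \<times> 'g) rel) g. directed r \<and>
     (\<forall>i\<in>Field r. g i \<noteq> 0) \<and>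
     filterlim (\<lambda>i. word_len \<Gamma> (g i)) at_top (net_filter r) \<and>
     (\<forall>(i, j)\<in>r. word_len \<Gamma> (g i) \<le> word_len \<Gamma> (g j)) \<and>
     tends_to_set r (\<lambda>i. K_set \<Gamma> (g i)) C)"

definition recurrent_I ::
  "('g::{monoid_add, topological_space} \<Rightarrow> 'x::topological_space \<Rightarrow> 'x) \<Rightarrow> 'g set \<Rightarrow> 'x \<Rightarrow> bool" where
  "recurrent_I act \<Gamma> x \<longleftrightarrow>
     (\<forall>C. gamma_cone \<Gamma> C \<longrightarrow> (\<forall>U\<in>nbhds_of x. (\<lambda>c. act c x) ` C \<inter> U \<noteq> {}))"

definition recurrent_II ::
  "('g::monoid_add \<Rightarrow> 'x::topological_space \<Rightarrow> 'x) \<Rightarrow> 'g set \<Rightarrow> 'x \<Rightarrow> bool" where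
  "recurrent_II act \<Gamma> x \<longleftrightarrow>
     (\<forall>U\<in>nbhds_of x. \<forall>(r :: ('g set \<times> 'g) rel) g.
        directed r \<longrightarrow> (\<forall>i\<in>Field r. g i \<noteq> 0) \<longrightarrow>
        filterlim (\<lambda>i. word_len \<Gamma> (g i)) at_top (net_filter r) \<longrightarrow>
        (\<exists>n\<ge>1. \<exists>(s :: ('g set \<times> 'g) rel) h c. subnet r s h \<and>
           (\<forall>j\<in>Field s. c j \<in> K_set \<Gamma> (g (h j)) \<and> act (c j) x \<in> U \<and> word_len \<Gamma> (c j) \<le> n)))"


section \<open>Independence of the index types\<close>

text \<open>
  The notions above that quantify over nets have the expected properties for nets and subnets over
  arbitrary index types.
\<close>

lemma orbit_closure_map_upper_limit_continuousD:
  fixes r :: "'i rel" and act :: "'g \<Rightarrow> 'x::topological_space \<Rightarrow> 'x"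
  assumes "orbit_closure_map_upper_limit_continuous act" "directed r" "(xs \<longlongrightarrow> x) (net_filter r)"
  shows "tends_to_set r (\<lambda>i. closure (orbit act (xs i))) (closure (orbit act x))"
proof -
  obtain s :: "('x set \<times> 'x) rel" where s: "directed s"
    "filtermap snd (net_filter s) = filtermap xs (net_filter r)"
    by (rule canonical_net[OF assms(2), of "\<lambda>_. 0" xs]) auto
  have "(snd \<longlongrightarrow> x) (net_filter s)"
    using assms(3) s(2) by (simp add: filterlim_def)
  then have "closure (orbit act x) = upper_limit s (\<lambda>i. closure (orbit act (snd i)))"
    using assms(1) s(1) unfolding orbit_closure_map_upper_limit_continuous_def tends_to_set_def
    by blast
  also have "\<dots> = upper_limit r (\<lambda>i. closure (orbit act (xs i)))"
    by (rule upper_limit_reindex[OF assms(2) s])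
  finally show ?thesis
    unfolding tends_to_set_def by (intro conjI ballI closed_closure)
qed

lemma orbit_closure_map_Hausdorff_continuousD:
  fixes r :: "'i rel" and act :: "'g \<Rightarrow> 'x::uniform_space \<Rightarrow> 'x"
  assumes "orbit_closure_map_Hausdorff_continuous act" "directed r" "(xs \<longlongrightarrow> x) (net_filter r)"
  shows "tends_to_Hausdorff r (\<lambda>i. closure (orbit act (xs i))) (closure (orbit act x))"
proof -
  obtain s :: "('x set \<times> 'x) rel" where s: "directed s"
    "filtermap snd (net_filter s) = filtermap xs (net_filter r)"
    by (rule canonical_net[OF assms(2), of "\<lambda>_. 0" xs]) auto
  have "(snd \<longlongrightarrow> x) (net_filter s)"
    using assms(3) s(2) by (simp add: filterlim_def)
  then have "tends_to_Hausdorff s (\<lambda>i. closure (orbit act (snd i))) (closure (orbit act x))"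
    using assms(1) s(1) unfolding orbit_closure_map_Hausdorff_continuous_def by blast
  then show ?thesis
    unfolding tends_to_Hausdorff_def
    using eventually_reindex[OF s(2), of "\<lambda>a. closure (orbit act a) \<subseteq> \<alpha> `` closure (orbit act x) \<and>
      closure (orbit act x) \<subseteq> \<alpha> `` closure (orbit act a)" for \<alpha>]
    by simp
qed

lemma filterlim_reindex:
  assumes "filtermap u (net_filter s) = filtermap x (net_filter r)"
  shows "filterlim (\<lambda>k. \<phi> (u k)) F (net_filter s) \<longleftrightarrow> filterlim (\<lambda>i. \<phi> (x i)) F (net_filter r)"
  using eventually_reindex[OF assms, of "\<lambda>a. P (\<phi> a)" for P] by (simp add: filterlim_iff)

lemma gamma_coneI:
  fixes r :: "'i rel" and \<Gamma> :: "'g::{monoid_add, topological_space} set"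
  assumes "directed r" "\<And>i. i \<in> Field r \<Longrightarrow> g i \<noteq> 0"
    and "filterlim (\<lambda>i. word_len \<Gamma> (g i)) at_top (net_filter r)"
    and "tends_to_set r (\<lambda>i. K_set \<Gamma> (g i)) C"
  shows "gamma_cone \<Gamma> C"
proof -
  have rank: "eventually (\<lambda>j. word_len \<Gamma> (g i) \<le> word_len \<Gamma> (g j)) (net_filter r)" for i
    using assms(3) unfolding filterlim_at_top by blast
  obtain s :: "('g set \<times> 'g) rel" where s: "directed s" "snd ` Field s \<subseteq> g ` Field r"
    "filtermap snd (net_filter s) = filtermap g (net_filter r)"
    "\<And>k l. (k, l) \<in> s \<Longrightarrow> word_len \<Gamma> (snd k) \<le> word_len \<Gamma> (snd l)"
    by (rule canonical_net[OF assms(1), of "word_len \<Gamma>" g, OF rank]) blast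
  have val: "\<exists>i\<in>Field r. snd k = g i" if "k \<in> Field s" for k
    using s(2) that by blast
  show ?thesis
    unfolding gamma_cone_def
  proof (intro exI conjI)
    show "directed s" by fact
    show "\<forall>k\<in>Field s. snd k \<noteq> 0"
      using val assms(2) by metis
    show "filterlim (\<lambda>k. word_len \<Gamma> (snd k)) at_top (net_filter s)"
      using assms(3) by (simp only: filterlim_reindex[OF s(3)])
    show "\<forall>(k, l)\<in>s. word_len \<Gamma> (snd k) \<le> word_len \<Gamma> (snd l)"
      using s(4) by blast
    have "upper_limit s (\<lambda>k. K_set \<Gamma> (snd k)) = upper_limit r (\<lambda>i. K_set \<Gamma> (g i))"
      by (rule upper_limit_reindex[OF assms(1) s(1,3)])
    moreover have "closed (K_set \<Gamma> (snd k))" if "k \<in> Field s" for k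
      using val[OF that] assms(4) unfolding tends_to_set_def by metis
    ultimately show "tends_to_set s (\<lambda>k. K_set \<Gamma> (snd k)) C"
      using assms(4) unfolding tends_to_set_def by metis
  qed
qed

lemma frequently_of_subnet:
  fixes r :: "'i rel" and s :: "'k rel"
  assumes "directed r" "subnet r s h" "\<And>k. k \<in> Field s \<Longrightarrow> P (h k) (c k)"
  shows "frequently (\<lambda>i. \<exists>d. P i d) (net_filter r)"
  unfolding frequently_net_filter[OF assms(1)]
proof
  fix i assume "i \<in> Field r"
  then obtain k where k: "k \<in> Field s" "\<And>l. (k, l) \<in> s \<Longrightarrow> (i, h l) \<in> r"
    using assms(2) unfolding subnet_def by blast
  have "directed s" using assms(2) by (simp only: subnet_def)
  then have "(k, k) \<in> s" by (rule directed_refl[OF _ k(1)])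
  then show "\<exists>j. (i, j) \<in> r \<and> (\<exists>d. P j d)"
    using k assms(3) by blast
qed

lemma subnet_of_frequently:
  fixes r :: "'i rel"
  assumes "directed r" "frequently (\<lambda>i. \<exists>d. P i d) (net_filter r)"
  shows "\<exists>(s :: 'i rel) h c. subnet r s h \<and> (\<forall>k\<in>Field s. P (h k) (c k))"
proof -
  define D where "D = {i \<in> Field r. \<exists>d. P i d}"
  define s where "s = {(i, j) \<in> r. i \<in> D \<and> j \<in> D}"
  have ex: "\<exists>j. (i, j) \<in> r \<and> j \<in> D" if "i \<in> Field r" for i
  proof -
    obtain j where j: "(i, j) \<in> r" "\<exists>d. P j d"
      using assms(2) \<open>i \<in> Field r\<close> unfolding frequently_net_filter[OF assms(1)] by blast
    from j(1) have "j \<in> Field r" by (rule FieldI2)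
    with j show ?thesis unfolding D_def by blast
  qed
  have refl: "(i, i) \<in> s" if "i \<in> D" for i
    using directed_refl[OF assms(1), of i] that by (simp add: s_def D_def)
  have Field_s: "Field s = D"
  proof
    show "Field s \<subseteq> D"
      by (auto simp: s_def Field_def)
    show "D \<subseteq> Field s"
      using refl by (blast intro: FieldI1)
  qed
  have "directed s"
    unfolding directed_def preorder_on_def Field_s
  proof (intro conjI ballI)
    obtain i where "i \<in> Field r" using directed_nonempty[OF assms(1)] .
    then show "s \<noteq> {}" using ex refl by blast
    show "s \<subseteq> D \<times> D" by (auto simp: s_def)
    show "refl_on D s" using refl by (simp add: refl_on_def)
    show "trans s"
    proof (rule transI)
      fix i j k assume ij: "(i, j) \<in> s" and jk: "(j, k) \<in> s"
      have "(i, j) \<in> r" "(j, k) \<in> r"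
        using ij jk unfolding s_def by simp_all
      then have "(i, k) \<in> r" by (rule directed_trans[OF assms(1)])
      then show "(i, k) \<in> s" using ij jk unfolding s_def by simp
    qed
  next
    fix i j assume ij: "i \<in> D" "j \<in> D"
    then have "i \<in> Field r" "j \<in> Field r" by (simp_all add: D_def)
    then obtain k where k: "(i, k) \<in> r" "(j, k) \<in> r"
      using directed_upper_bound[OF assms(1)] by blast
    from k(1) have "k \<in> Field r" by (rule FieldI2)
    then obtain l where l: "(k, l) \<in> r" "l \<in> D" using ex by blast
    have "(i, l) \<in> r" by (rule directed_trans[OF assms(1) k(1) l(1)])
    moreover have "(j, l) \<in> r" by (rule directed_trans[OF assms(1) k(2) l(1)])
    ultimately show "\<exists>l. (i, l) \<in> s \<and> (j, l) \<in> s"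
      using ij l(2) unfolding s_def by blast
  qed
  moreover have "\<exists>k\<in>Field s. \<forall>l. (k, l) \<in> s \<longrightarrow> (i, l) \<in> r" if iF: "i \<in> Field r" for i
  proof -
    obtain j where j: "(i, j) \<in> r" "j \<in> D" using ex[OF iF] by blast
    have "(i, l) \<in> r" if "(j, l) \<in> s" for l
    proof (rule directed_trans[OF assms(1) j(1)])
      show "(j, l) \<in> r" using that unfolding s_def by simp
    qed
    with j(2) show ?thesis unfolding Field_s by blast
  qed
  moreover have "id ` Field s \<subseteq> Field r"
    by (auto simp: Field_s D_def)
  ultimately have "subnet r s id"
    unfolding subnet_def by simp
  moreover have "\<forall>k\<in>Field s. P (id k) (SOME d. P k d)"
    unfolding Field_s D_def by (auto intro: someI_ex)
  ultimately show ?thesis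
    by (intro exI[of _ s] exI[of _ id] exI[of _ "\<lambda>k. SOME d. P k d"]) simp
qed

lemma recurrent_II_D:
  fixes r :: "'i rel"
  assumes "recurrent_II act \<Gamma> x" "U \<in> nbhds_of x" "directed r" "\<And>i. i \<in> Field r \<Longrightarrow> g i \<noteq> 0"
    and "filterlim (\<lambda>i. word_len \<Gamma> (g i)) at_top (net_filter r)"
  shows "\<exists>n\<ge>1. \<exists>(s :: 'i rel) h c. subnet r s h \<and>
    (\<forall>j\<in>Field s. c j \<in> K_set \<Gamma> (g (h j)) \<and> act (c j) x \<in> U \<and> word_len \<Gamma> (c j) \<le> n)"
proof -
  obtain s :: "('a set \<times> 'a) rel" where s: "directed s" "snd ` Field s \<subseteq> g ` Field r"
    "filtermap snd (net_filter s) = filtermap g (net_filter r)"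
    by (rule canonical_net[OF assms(3), of "\<lambda>_. 0" g]) auto
  have nz: "\<forall>k\<in>Field s. snd k \<noteq> 0"
    using s(2) assms(4) by fastforce
  have lim: "filterlim (\<lambda>k. word_len \<Gamma> (snd k)) at_top (net_filter s)"
    using assms(5) by (simp only: filterlim_reindex[OF s(3)])
  note rec = bspec[OF assms(1)[unfolded recurrent_II_def] assms(2), THEN spec[where x = s],
      THEN spec[where x = snd], THEN mp, OF s(1), THEN mp, OF nz, THEN mp, OF lim]
  from rec obtain n and s' :: "('a set \<times> 'a) rel" and h c where n: "n \<ge> 1" and s': "subnet s s' h"
    and c: "\<And>j. j \<in> Field s' \<Longrightarrow> c j \<in> K_set \<Gamma> (snd (h j)) \<and> act (c j) x \<in> U \<and> word_len \<Gamma> (c j) \<le> n"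
    by blast
  define P where "P a d \<longleftrightarrow> d \<in> K_set \<Gamma> a \<and> act d x \<in> U \<and> word_len \<Gamma> d \<le> n" for a d
  have "frequently (\<lambda>k. \<exists>d. P (snd k) d) (net_filter s)"
    by (rule frequently_of_subnet[OF s(1) s']) (use c in \<open>simp add: P_def\<close>)
  then have "frequently (\<lambda>i. \<exists>d. P (g i) d) (net_filter r)"
    unfolding frequently_def using eventually_reindex[OF s(3), of "\<lambda>a. \<not> (\<exists>d. P a d)"] by simp
  from subnet_of_frequently[OF assms(3) this] n show ?thesis
    unfolding P_def by blast
qed

lemma recurrent_II_I:
  fixes act :: "'g::monoid_add \<Rightarrow> 'x::topological_space \<Rightarrow> 'x"
  assumes "\<And>U (r :: ('g set \<times> 'g) rel) g. U \<in> nbhds_of x \<Longrightarrow> directed r \<Longrightarrow>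
    (\<And>i. i \<in> Field r \<Longrightarrow> g i \<noteq> 0) \<Longrightarrow>
    filterlim (\<lambda>i. word_len \<Gamma> (g i)) at_top (net_filter r) \<Longrightarrow>
    \<exists>n\<ge>1. \<exists>(s :: 'k rel) h c. subnet r s h \<and>
      (\<forall>j\<in>Field s. c j \<in> K_set \<Gamma> (g (h j)) \<and> act (c j) x \<in> U \<and> word_len \<Gamma> (c j) \<le> n)"
  shows "recurrent_II act \<Gamma> x"
  unfolding recurrent_II_def
proof (intro ballI allI impI)
  fix U and r :: "('g set \<times> 'g) rel" and g
  assume r: "U \<in> nbhds_of x" "directed r" "\<forall>i\<in>Field r. g i \<noteq> 0"
    "filterlim (\<lambda>i. word_len \<Gamma> (g i)) at_top (net_filter r)"
  obtain n and s :: "'k rel" and h c where n: "n \<ge> 1" and s: "subnet r s h"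
    and c: "\<And>j. j \<in> Field s \<Longrightarrow> c j \<in> K_set \<Gamma> (g (h j)) \<and> act (c j) x \<in> U \<and> word_len \<Gamma> (c j) \<le> n"
    using assms[of U r g, OF r(1,2) bspec[OF r(3)] r(4)] by blast
  define P where "P i d \<longleftrightarrow> d \<in> K_set \<Gamma> (g i) \<and> act d x \<in> U \<and> word_len \<Gamma> d \<le> n" for i d
  have "frequently (\<lambda>i. \<exists>d. P i d) (net_filter r)"
    by (rule frequently_of_subnet[OF r(2) s]) (use c in \<open>simp add: P_def\<close>)
  from subnet_of_frequently[OF r(2) this] n
  show "\<exists>n\<ge>1. \<exists>(s :: ('g set \<times> 'g) rel) h c. subnet r s h \<and>
      (\<forall>j\<in>Field s. c j \<in> K_set \<Gamma> (g (h j)) \<and> act (c j) x \<in> U \<and> word_len \<Gamma> (c j) \<le> n)"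
    unfolding P_def by blast
qed

end

theory Submission
  imports Defs
begin

text \<open>
  Everything is reduced to one property: for compact open \<open>U\<close>, the set of points whose orbit stays
  in \<open>U\<close> is open (\<open>open_cores\<close> below). If it fails at \<open>x\<close>, there are \<open>z\<^sub>i \<rightarrow> x\<close> and shortest words
  \<open>g\<^sub>i\<close> with \<open>g\<^sub>i z\<^sub>i \<notin> U\<close>. Compactness of the powers of \<open>\<Gamma>\<close> makes their lengths tend to infinity,
  and the exit points accumulate at some \<open>y \<notin> U\<close>, because they lie in the compact set \<open>\<Gamma>U\<close>.
  By minimality \<open>K(g\<^sub>i\<^sup>-\<^sup>1)\<close> moves the exit points back into the closed set \<open>U\<close>, so the cone of the net
  \<open>g\<^sub>i\<^sup>-\<^sup>1\<close> maps \<open>y\<close> into \<open>U\<close>, and \<open>y\<close> is not recurrent of type I.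

  The cycle is type II, type I, \<open>open_cores\<close>, closed orbit closure relation, symmetry of
  \<open>y \<in> closure (orbit act x)\<close>, type II. For the last step, symmetry and compactness give a
  finite set of times that returns every point of an orbit closure to a neighbourhood of \<open>x\<close>.
  Finiteness matters: word length need not be bounded on an arbitrary compact set of times.
\<close>

section \<open>Nets, filters and cluster points\<close>

lemma net_filter_nontrivial:
  assumes "directed r"
  shows "net_filter r \<noteq> bot"
  unfolding trivial_limit_def eventually_net_filter[OF assms]
  using directed_refl[OF assms] by blast

text \<open>The indices are pairs of a filter member inside \<open>S\<close> and a point of it,
  ordered by reverse inclusion of the sets. For filters on the space, this is exactly the index type
  over which the continuity notions quantify.\<close>

lemma net_of_filter:
  fixes F :: "'a filter"
  assumes "F \<noteq> bot" "eventually (\<lambda>a. a \<in> S) F"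
  obtains r :: "('a set \<times> 'a) rel" where "directed r" "snd ` Field r \<subseteq> S"
    "filtermap snd (net_filter r) = F"
proof -
  define D where "D = {(A, a). eventually (\<lambda>a. a \<in> A) F \<and> A \<subseteq> S \<and> a \<in> A}"
  define r where "r = {(k, l). k \<in> D \<and> l \<in> D \<and> fst l \<subseteq> fst k}"
  have Field_r: "Field r = D"
    by (auto simp: r_def Field_def)
  have ex: "\<exists>a. (A, a) \<in> D" if "eventually (\<lambda>a. a \<in> A) F" "A \<subseteq> S" for A
  proof -
    have "\<exists>a. a \<in> A"
      using eventually_happens'[OF assms(1) that(1)] .
    with that show ?thesis by (auto simp: D_def)
  qed
  have "directed r"
    unfolding directed_def preorder_on_def Field_r
  proof (intro conjI ballI)
    obtain a where "(S, a) \<in> D" using ex[OF assms(2)] by blast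
    then show "r \<noteq> {}" by (auto simp: r_def)
    show "r \<subseteq> D \<times> D" "refl_on D r" "trans r"
      by (auto simp: r_def refl_on_def trans_def)
  next
    fix k l assume kl: "k \<in> D" "l \<in> D"
    then have "eventually (\<lambda>a. a \<in> fst k \<inter> fst l) F" "fst k \<inter> fst l \<subseteq> S"
      by (auto simp: D_def eventually_conj_iff)
    then obtain a where "(fst k \<inter> fst l, a) \<in> D" using ex by blast
    with kl show "\<exists>m. (k, m) \<in> r \<and> (l, m) \<in> r"
      by (intro exI[of _ "(fst k \<inter> fst l, a)"]) (auto simp: r_def)
  qed
  moreover have "snd ` Field r \<subseteq> S"
    unfolding Field_r by (auto simp: D_def)
  moreover have "filtermap snd (net_filter r) = F"
    unfolding filter_eq_iff eventually_filtermap eventually_net_filter[OF \<open>directed r\<close>] Field_r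
  proof (intro allI iffI)
    fix P assume "\<exists>k\<in>D. \<forall>l. (k, l) \<in> r \<longrightarrow> P (snd l)"
    then obtain A a where k: "(A, a) \<in> D" "\<And>l. ((A, a), l) \<in> r \<Longrightarrow> P (snd l)" by auto
    \<comment> \<open>The order ignores the chosen point, so every \<open>(A, b)\<close> lies above
      \<open>(A, a)\<close> and the tail covers all of \<open>A\<close>.\<close>
    have "P b" if "b \<in> A" for b
      using k(2)[of "(A, b)"] k(1) that by (auto simp: r_def D_def)
    moreover have "eventually (\<lambda>b. b \<in> A) F"
      using k(1) by (simp add: D_def)
    ultimately show "eventually P F"
      by (auto elim: eventually_mono)
  next
    fix P assume "eventually P F"
    then have "eventually (\<lambda>a. a \<in> {a \<in> S. P a}) F"
      using assms(2) by eventually_elim simp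
    then obtain a where "({a \<in> S. P a}, a) \<in> D" using ex[of "{a \<in> S. P a}"] by auto
    then show "\<exists>k\<in>D. \<forall>l. (k, l) \<in> r \<longrightarrow> P (snd l)"
      by (intro bexI[of _ "({a \<in> S. P a}, a)"]) (auto simp: r_def D_def)
  qed
  ultimately show ?thesis by (rule that)
qed

lemma net_in_closure:
  fixes y :: "'x::topological_space"
  assumes "y \<in> closure S"
  obtains r :: "('x set \<times> 'x) rel" where "directed r" "snd ` Field r \<subseteq> S"
    "(snd \<longlongrightarrow> y) (net_filter r)"
proof -
  let ?F = "inf (nhds y) (principal S)"
  have "?F \<noteq> bot"
  proof
    assume "?F = bot"
    then have "eventually (\<lambda>a. a \<notin> S) (nhds y)"
      by (simp add: trivial_limit_def eventually_inf_principal)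
    then obtain U where "open U" "y \<in> U" "U \<inter> S = {}"
      unfolding eventually_nhds by blast
    with assms show False
      by (metis Int_commute closure_iff_nhds_not_empty order_refl)
  qed
  moreover have "eventually (\<lambda>a. a \<in> S) ?F"
    by (simp add: eventually_inf_principal)
  ultimately obtain r :: "('x set \<times> 'x) rel" where r: "directed r" "snd ` Field r \<subseteq> S"
      "filtermap snd (net_filter r) = ?F"
    by (rule net_of_filter)
  then have "(snd \<longlongrightarrow> y) (net_filter r)"
    by (simp add: filterlim_def)
  with r show ?thesis by (intro that)
qed

text \<open>The second claim provides a proper filter finer than \<open>F\<close> along which
  \<open>f\<close> converges to \<open>c\<close>, the counterpart of a convergent subnet. The third
  is the usual description of a cluster point.\<close>

lemma compact_cluster_point:
  assumes "compact L" "F \<noteq> bot" "eventually (\<lambda>k. f k \<in> L) F"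
  obtains c where "c \<in> L" "inf F (filtercomap f (nhds c)) \<noteq> bot"
    "\<And>W. open W \<Longrightarrow> c \<in> W \<Longrightarrow> frequently (\<lambda>k. f k \<in> W) F"
proof -
  have "filtermap f F \<noteq> bot" "eventually (\<lambda>a. a \<in> L) (filtermap f F)"
    using assms(2,3) by (simp_all add: filtermap_bot_iff eventually_filtermap)
  then obtain c where c: "c \<in> L" "inf (nhds c) (filtermap f F) \<noteq> bot"
    using assms(1) unfolding compact_filter by blast
  have freq: "frequently (\<lambda>k. f k \<in> W) F" if "open W" "c \<in> W" for W
  proof (rule ccontr)
    assume "\<not> ?thesis"
    then have "eventually (\<lambda>a. a \<notin> W) (filtermap f F)"
      by (simp add: frequently_def eventually_filtermap)
    moreover have "eventually (\<lambda>a. a \<in> W) (nhds c)"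
      using that by (rule eventually_nhds_in_open)
    ultimately have "eventually (\<lambda>_. False) (inf (nhds c) (filtermap f F))"
      unfolding eventually_inf by fast
    with c(2) show False by (simp add: trivial_limit_def)
  qed
  have "inf F (filtercomap f (nhds c)) \<noteq> bot"
  proof
    assume "inf F (filtercomap f (nhds c)) = bot"
    then have "eventually (\<lambda>_. False) (inf F (filtercomap f (nhds c)))" by simp
    then obtain P Q where PQ: "eventually P F" "eventually Q (nhds c)" "\<And>k. P k \<Longrightarrow> Q (f k) \<Longrightarrow> False"
      unfolding eventually_inf eventually_filtercomap by blast
    obtain W where W: "open W" "c \<in> W" "\<And>a. a \<in> W \<Longrightarrow> Q a"
      using PQ(2) unfolding eventually_nhds by blast
    have "eventually (\<lambda>k. f k \<notin> W) F"
      using PQ(1) by eventually_elim (use PQ(3) W(3) in blast)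
    then show False using freq[OF W(1,2)] by (simp add: frequently_def)
  qed
  with c(1) freq show ?thesis by (intro that)
qed

lemma closed_upper_limit:
  assumes "directed r"
  shows "closed (upper_limit r Y)"
proof -
  have "open (- upper_limit r Y)"
  proof (subst open_subopen, intro ballI)
    fix y assume "y \<in> - upper_limit r Y"
    then obtain U where "open U" "y \<in> U" "\<not> frequently (\<lambda>i. Y i \<inter> U \<noteq> {}) (net_filter r)"
      by (auto simp: mem_upper_limit_iff[OF assms])
    then show "\<exists>T. open T \<and> y \<in> T \<and> T \<subseteq> - upper_limit r Y"
      by (intro exI[of _ U]) (auto simp: mem_upper_limit_iff[OF assms])
  qed
  then show ?thesis by (simp add: closed_def)
qed

text \<open>Points chosen in \<open>Y i \<inter> L \<inter> E\<close> cluster because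
  \<open>L\<close> is compact, and the closed set \<open>E\<close> keeps the cluster point. In the
  application \<open>L\<close> is a power of \<open>\<Gamma>\<close>, so that bounded word length
  prevents an escape to infinity.\<close>

lemma upper_limit_inter_compact:
  fixes Y :: "'i \<Rightarrow> 'y::topological_space set"
  assumes "directed r" "compact L" "closed E"
    and freq: "frequently (\<lambda>i. Y i \<inter> L \<inter> E \<noteq> {}) (net_filter r)"
  shows "upper_limit r Y \<inter> E \<noteq> {}"
proof -
  define S where "S = {i. Y i \<inter> L \<inter> E \<noteq> {}}"
  define F where "F = inf (net_filter r) (principal S)"
  define f where "f i = (SOME d. d \<in> Y i \<inter> L \<inter> E)" for i
  have f: "f i \<in> Y i \<inter> L \<inter> E" if "i \<in> S" for i
    unfolding f_def by (rule someI_ex) (use that in \<open>auto simp: S_def\<close>)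
  have S: "eventually (\<lambda>i. i \<in> S) F"
    by (simp add: F_def eventually_inf_principal)
  have "F \<noteq> bot"
    using freq by (simp add: F_def trivial_limit_def eventually_inf_principal frequently_def S_def)
  moreover have "eventually (\<lambda>i. f i \<in> L) F"
    using S by eventually_elim (use f in blast)
  ultimately obtain c where c: "\<And>W. open W \<Longrightarrow> c \<in> W \<Longrightarrow> frequently (\<lambda>i. f i \<in> W) F"
    using compact_cluster_point[OF assms(2)] by metis
  have "c \<in> E"
  proof (rule ccontr)
    assume "c \<notin> E"
    then have "frequently (\<lambda>i. f i \<in> - E) F"
      using assms(3) by (intro c) auto
    moreover have "eventually (\<lambda>i. f i \<notin> - E) F"
      using S by eventually_elim (use f in blast)
    ultimately show False by (simp add: frequently_def)
  qed
  moreover have "c \<in> upper_limit r Y"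
    unfolding mem_upper_limit_iff[OF assms(1)]
  proof (intro allI impI)
    fix W assume "open W" "c \<in> W"
    then have "frequently (\<lambda>i. f i \<in> W) F" by (rule c)
    then have "frequently (\<lambda>i. i \<in> S \<and> f i \<in> W) (net_filter r)"
      by (simp add: F_def frequently_def eventually_inf_principal)
    then show "frequently (\<lambda>i. Y i \<inter> W \<noteq> {}) (net_filter r)"
      by (rule frequently_elim1) (use f in blast)
  qed
  ultimately show ?thesis by blast
qed

section \<open>Word length\<close>

lemma set_pow_add: "set_pow \<Gamma> (m + n) = set_pow \<Gamma> m + set_pow \<Gamma> n"
proof (induction n)
  case 0
  show ?case by (simp add: set_plus_def)
next
  case (Suc n)
  then show ?case by (simp add: add.assoc)
qed

lemma set_pow_mono:
  assumes "0 \<in> \<Gamma>" "m \<le> n"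
  shows "set_pow \<Gamma> m \<subseteq> set_pow \<Gamma> n"
  using assms(2)
proof (induction rule: dec_induct)
  case (step n)
  have "set_pow \<Gamma> n \<subseteq> set_pow \<Gamma> (Suc n)"
    using assms(1) by (force simp: set_plus_def)
  with step show ?case by blast
qed simp

lemma compact_set_pow:
  fixes \<Gamma> :: "'g::topological_monoid_add set"
  assumes "compact \<Gamma>"
  shows "compact (set_pow \<Gamma> n)"
proof (induction n)
  case (Suc n)
  have "continuous_on (set_pow \<Gamma> n \<times> \<Gamma>) (\<lambda>(a, b). a + b)"
    by (auto simp: split_beta' intro!: continuous_intros)
  then have "compact ((\<lambda>(a, b). a + b) ` (set_pow \<Gamma> n \<times> \<Gamma>))"
    by (rule compact_continuous_image) (intro compact_Times Suc assms)
  then show ?case by (simp add: set_plus_image)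
qed simp

locale compactly_generated =
  fixes \<Gamma> :: "'g::{group_add, topological_monoid_add, t2_space} set"
  assumes generating: "compact_generating_set \<Gamma>"
begin

lemma compact_Gamma: "compact \<Gamma>" and zero_mem: "0 \<in> \<Gamma>" and symmetric: "\<Gamma> = uminus ` \<Gamma>"
  using generating by (simp_all add: compact_generating_set_def)

lemma mem_set_pow_word_len: "g \<in> set_pow \<Gamma> (word_len \<Gamma> g)"
proof -
  have "g \<in> (\<Union>r\<in>{1..}. set_pow \<Gamma> r)"
    using generating unfolding compact_generating_set_def by blast
  then show ?thesis
    unfolding word_len_def by (auto intro: LeastI)
qed

lemma mem_set_pow_iff: "g \<in> set_pow \<Gamma> n \<longleftrightarrow> word_len \<Gamma> g \<le> n"
proof
  show "g \<in> set_pow \<Gamma> n \<Longrightarrow> word_len \<Gamma> g \<le> n"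
    unfolding word_len_def by (rule Least_le)
  show "word_len \<Gamma> g \<le> n \<Longrightarrow> g \<in> set_pow \<Gamma> n"
    using set_pow_mono[OF zero_mem] mem_set_pow_word_len by blast
qed

lemma uminus_mem_set_pow: "g \<in> set_pow \<Gamma> n \<Longrightarrow> - g \<in> set_pow \<Gamma> n"
proof (induction n arbitrary: g)
  case (Suc n)
  then obtain a b where ab: "g = a + b" "a \<in> set_pow \<Gamma> n" "b \<in> \<Gamma>"
    by (auto simp: set_plus_def)
  have "- b \<in> \<Gamma>" using ab(3) symmetric by blast
  moreover have "- g = - b + - a" by (simp only: ab(1) minus_add)
  \<comment> \<open>Negation reverses words: the new letter arrives in front, whereas
    \<open>set_pow\<close> appends at the end. Additivity of exponents reconciles the two.\<close>
  ultimately have "- g \<in> set_pow \<Gamma> 1 + set_pow \<Gamma> n"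
    using Suc.IH[OF ab(2)] by (simp add: set_plus_intro flip: set_zero del: add_uminus_conv_diff)
  then show ?case
    by (simp only: set_pow_add[symmetric] plus_1_eq_Suc)
qed simp

lemma word_len_uminus: "word_len \<Gamma> (- g) = word_len \<Gamma> g"
  by (metis antisym mem_set_pow_iff minus_minus order_refl uminus_mem_set_pow)

lemma closed_K_set: "closed (K_set \<Gamma> g)"
  unfolding K_set_def
  by (intro compact_imp_closed compact_continuous_image compact_set_pow compact_Gamma continuous_intros)

end

section \<open>Orbit closures\<close>

locale zero_dim_flow =
  fixes act :: "'g::{group_add, topological_monoid_add, t2_space} \<Rightarrow> 'x::{uniform_space, t2_space} \<Rightarrow> 'x"
  assumes flow: "flow act" and zero_dim: "zero_dimensional TYPE('x)"
begin

abbreviation oc :: "'x \<Rightarrow> 'x set" where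
  "oc x \<equiv> closure (orbit act x)"

definition invariant_core :: "'x set \<Rightarrow> 'x set" where
  "invariant_core U = {x. \<forall>t. act t x \<in> U}"

section \<open>Continuity of the action in times and points\<close>

lemma act_0: "act 0 x = x" and act_add: "act (s + t) x = act s (act t x)"
  and compact_oc: "compact (oc x)"
  using flow by (auto simp: flow_def)

lemma act_minus: "act (- t) (act t x) = x"
  by (metis act_0 act_add add.left_inverse)

lemma open_act_vimage: "open U \<Longrightarrow> open {(t, x). act t x \<in> U}"
  using flow open_vimage[of U "\<lambda>(t, x). act t x"]
  by (simp add: flow_def vimage_def split_beta')

lemma continuous_on_act:
  assumes "continuous_on S f" "continuous_on S h"
  shows "continuous_on S (\<lambda>a. act (f a) (h a))"
proof -
  have "continuous_on UNIV (\<lambda>(t, x). act t x)"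
    using flow by (simp add: flow_def)
  from continuous_on_compose2[OF this continuous_on_Pair[OF assms]] show ?thesis by simp
qed

lemma open_time_set: "open U \<Longrightarrow> open {t. act t x \<in> U}"
  using open_vimage[of U "\<lambda>t. act t x"] by (simp add: continuous_on_act vimage_def)

lemma open_point_set: "open U \<Longrightarrow> open {x. act t x \<in> U}"
  using open_vimage[of U "act t"] by (simp add: continuous_on_act vimage_def)

text \<open>The tube lemma turns joint continuity into a neighbourhood that works for all times of a
  compact set at once.\<close>

lemma eventually_compact_act:
  assumes "compact L" "open U" "\<And>t. t \<in> L \<Longrightarrow> act t x \<in> U"
  shows "eventually (\<lambda>y. \<forall>t\<in>L. act t y \<in> U) (nhds x)"
proof -
  have "open {(y, t). act t y \<in> U}"
    using open_vimage[OF open_act_vimage[OF assms(2)], of prod.swap]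
    by (simp add: vimage_def split_beta' continuous_on_swap)
  moreover have "{x} \<times> L \<subseteq> {(y, t). act t y \<in> U}"
    using assms(3) by auto
  ultimately obtain V where "x \<in> V" "open V" "V \<times> L \<subseteq> {(y, t). act t y \<in> U}"
    using Elementary_Topology.tube_lemma[OF assms(1), of "{(y, t). act t y \<in> U}" x] by blast
  then show ?thesis unfolding eventually_nhds by blast
qed

text \<open>A basic clopen set inside a compact neighbourhood is compact, so each point of
  \<open>K\<close> has a compact open neighbourhood inside \<open>W\<close>; finitely many of them
  cover \<open>K\<close>. Zero-dimensionality and local compactness enter the proof here.\<close>

lemma compact_open_between:
  fixes K :: "'x set"
  assumes "compact K" "open W" "K \<subseteq> W"
  obtains U where "compact U" "open U" "K \<subseteq> U" "U \<subseteq> W"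
proof -
  obtain B :: "'x set set" where B: "topological_basis B" "\<forall>b\<in>B. open b \<and> closed b"
    using zero_dim unfolding zero_dimensional_def by blast
  define C where "C = {b. compact b \<and> open b \<and> b \<subseteq> W}"
  have "\<exists>b\<in>C. x \<in> b" if "x \<in> K" for x
  proof -
    have "locally_compact_space (euclidean :: 'x topology)"
      using flow by (simp add: flow_def)
    then have "\<forall>x :: 'x. \<exists>V. open V \<and> (\<exists>N. compact N \<and> x \<in> V \<and> V \<subseteq> N)"
      by (simp add: locally_compact_space_def flip: open_openin)
    then obtain V N where VN: "open V" "compact N" "x \<in> V" "V \<subseteq> N" by metis
    then obtain b where b: "b \<in> B" "x \<in> b" "b \<subseteq> V \<inter> W"
      using topological_basisE[OF B(1), of "V \<inter> W" x] assms \<open>x \<in> K\<close> by (metis Int_iff open_Int subsetD)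
    moreover have "compact (N \<inter> b)"
      using B(2) VN b by (intro compact_Int_closed) auto
    moreover have "N \<inter> b = b"
      using VN b by blast
    ultimately show ?thesis using B(2) by (auto simp: C_def)
  qed
  then have "K \<subseteq> \<Union>C" by blast
  moreover have "open b" if "b \<in> C" for b
    using that by (simp add: C_def)
  ultimately obtain D where D: "D \<subseteq> C" "finite D" "K \<subseteq> \<Union>D"
    by (rule compactE[OF assms(1)])
  show ?thesis
  proof (rule that)
    show "compact (\<Union>D)" using D by (intro compact_Union) (auto simp: C_def)
    show "open (\<Union>D)" using D by (intro open_Union) (auto simp: C_def)
    show "\<Union>D \<subseteq> W" using D by (auto simp: C_def)
  qed fact
qed

lemma compact_open_nbhd:
  fixes x :: 'x
  assumes "U \<in> nbhds_of x"
  obtains E where "compact E" "open E" "x \<in> E" "E \<subseteq> U"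
proof -
  obtain W where "open W" "x \<in> W" "W \<subseteq> U"
    using assms unfolding nbhds_of_def eventually_nhds by blast
  moreover obtain E where "compact E" "open E" "{x} \<subseteq> E" "E \<subseteq> W"
    using compact_open_between[of "{x}" W] calculation by auto
  ultimately show ?thesis by (intro that[of E]) auto
qed

lemma nbhds_of_open: "open U \<Longrightarrow> x \<in> U \<Longrightarrow> U \<in> nbhds_of x"
  by (simp add: nbhds_of_def eventually_nhds_in_open)

section \<open>Invariance and inclusion of orbit closures\<close>

lemma self_in_oc: "x \<in> oc x"
  by (metis act_0 closure_subset orbit_def rangeI subsetD)

lemma act_in_oc: "y \<in> oc x \<Longrightarrow> act t y \<in> oc x"
proof -
  assume "y \<in> oc x"
  moreover have "act t ` oc x \<subseteq> oc x"
  proof (rule image_closure_subset)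
    show "continuous_on (oc x) (act t)"
      by (intro continuous_on_act continuous_intros)
    have "act t ` orbit act x \<subseteq> orbit act x"
      unfolding orbit_def by (auto simp flip: act_add)
    then show "act t ` orbit act x \<subseteq> oc x"
      using closure_subset by blast
  qed simp
  ultimately show ?thesis by blast
qed

lemma oc_subset: "y \<in> oc x \<Longrightarrow> oc y \<subseteq> oc x"
  using act_in_oc by (intro closure_minimal) (auto simp: orbit_def)

lemma oc_act: "oc (act t x) = oc x"
  by (metis act_in_oc act_minus antisym oc_subset self_in_oc)

lemma oc_subset_iff:
  assumes "closed U"
  shows "oc x \<subseteq> U \<longleftrightarrow> x \<in> invariant_core U"
proof
  show "oc x \<subseteq> U \<Longrightarrow> x \<in> invariant_core U"
    using act_in_oc[OF self_in_oc] by (auto simp: invariant_core_def)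
  show "x \<in> invariant_core U \<Longrightarrow> oc x \<subseteq> U"
    using assms by (intro closure_minimal) (auto simp: invariant_core_def orbit_def)
qed

lemma closure_orbit_meets_open:
  assumes "y \<in> oc x" "open U" "y \<in> U"
  obtains t where "act t x \<in> U"
  using assms open_Int_closure_eq_empty[of U "orbit act x"] by (auto simp: orbit_def)

section \<open>Symmetry of the orbit closure relation\<close>

text \<open>Membership in orbit closures is always reflexive and, by \<open>oc_subset\<close>,
  transitive. Symmetry therefore makes it an equivalence relation, whose classes are the minimal
  sets.\<close>

definition orbit_closures_symmetric :: bool where
  "orbit_closures_symmetric \<longleftrightarrow> (\<forall>x. \<forall>y\<in>oc x. x \<in> oc y)"

lemma symmetric_iff_union_minimal:
  "orbit_closures_symmetric \<longleftrightarrow> (\<exists>\<M>. (\<forall>K\<in>\<M>. minimal_set act K) \<and> \<Union>\<M> = UNIV)"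
proof
  assume sym: orbit_closures_symmetric
  have "oc y = oc x" if "y \<in> oc x" for x y
    using sym that unfolding orbit_closures_symmetric_def by (meson antisym oc_subset)
  then have "\<forall>K\<in>range oc. minimal_set act K"
    by (auto simp: minimal_set_def)
  moreover have "\<Union>(range oc) = UNIV"
    using self_in_oc by auto
  ultimately show "\<exists>\<M>. (\<forall>K\<in>\<M>. minimal_set act K) \<and> \<Union>\<M> = UNIV" by blast
next
  assume "\<exists>\<M>. (\<forall>K\<in>\<M>. minimal_set act K) \<and> \<Union>\<M> = UNIV"
  then obtain \<M> where \<M>: "\<forall>K\<in>\<M>. minimal_set act K" "\<Union>\<M> = UNIV"
    by (elim exE conjE)
  show orbit_closures_symmetric
    unfolding orbit_closures_symmetric_def
  proof (intro allI ballI)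
    fix x y assume "y \<in> oc x"
    obtain K where K: "x \<in> K" "K \<in> \<M>"
      using \<M>(2) by (metis UNIV_I UnionE)
    have "oc z = K" if "z \<in> K" for z
      using \<M>(1) K(2) that by (simp add: minimal_set_def)
    with K(1) \<open>y \<in> oc x\<close> show "x \<in> oc y" by simp
  qed
qed

text \<open>The slice of all \<open>z\<close> with \<open>x \<in> oc z\<close> is closed and
  contains the orbit of \<open>x\<close>, hence also its closure.\<close>

lemma closed_imp_symmetric:
  assumes "closed (orbit_closure_relation act)"
  shows orbit_closures_symmetric
  unfolding orbit_closures_symmetric_def
proof (intro allI ballI)
  fix x y assume "y \<in> oc x"
  have "closed {z. (z, x) \<in> orbit_closure_relation act}"
    using closed_vimage[OF assms, of "\<lambda>z. (z, x)"] by (simp add: vimage_def continuous_on_Pair)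
  moreover have "orbit act x \<subseteq> {z. (z, x) \<in> orbit_closure_relation act}"
    unfolding orbit_def orbit_closure_relation_def using oc_act self_in_oc by (auto simp: orbit_def)
  ultimately have "oc x \<subseteq> {z. (z, x) \<in> orbit_closure_relation act}"
    by (rule closure_minimal[rotated])
  with \<open>y \<in> oc x\<close> show "x \<in> oc y"
    by (auto simp: orbit_closure_relation_def)
qed

text \<open>Along a net in the orbit of \<open>x\<close> tending to \<open>y\<close> the orbit
  closures are constantly \<open>oc x\<close>. Their limit contains \<open>x\<close>, and by
  continuity it is \<open>oc y\<close>.\<close>

lemma upper_limit_continuous_imp_symmetric:
  assumes "orbit_closure_map_upper_limit_continuous act"
  shows orbit_closures_symmetric
  unfolding orbit_closures_symmetric_def
proof (intro allI ballI)
  fix x y assume "y \<in> oc x"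
  then obtain r :: "('x set \<times> 'x) rel" where r: "directed r" "snd ` Field r \<subseteq> orbit act x"
      "(snd \<longlongrightarrow> y) (net_filter r)"
    by (rule net_in_closure)
  have "x \<in> upper_limit r (\<lambda>k. oc (snd k))"
    unfolding mem_upper_limit_iff[OF r(1)] frequently_net_filter[OF r(1)]
  proof (intro allI impI ballI)
    fix U k assume U: "open U" "x \<in> U" and k: "k \<in> Field r"
    then obtain t where "snd k = act t x" using r(2) by (auto simp: orbit_def)
    then have "x \<in> oc (snd k) \<inter> U" using U self_in_oc by (simp add: oc_act)
    then show "\<exists>l. (k, l) \<in> r \<and> oc (snd l) \<inter> U \<noteq> {}"
      using directed_refl[OF r(1) k] by blast
  qed
  then show "x \<in> oc y"
    using assms r unfolding orbit_closure_map_upper_limit_continuous_def tends_to_set_def by blast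
qed

text \<open>The net is again one in the orbit of \<open>x\<close> tending to \<open>y\<close>; this
  time an entourage separates \<open>x\<close> from the closed set \<open>oc y\<close>.\<close>

lemma Hausdorff_continuous_imp_symmetric:
  assumes "orbit_closure_map_Hausdorff_continuous act"
  shows orbit_closures_symmetric
  unfolding orbit_closures_symmetric_def
proof (intro allI ballI)
  fix x y assume "y \<in> oc x"
  then obtain r :: "('x set \<times> 'x) rel" where r: "directed r" "snd ` Field r \<subseteq> orbit act x"
      "(snd \<longlongrightarrow> y) (net_filter r)"
    by (rule net_in_closure)
  have lim: "tends_to_Hausdorff r (\<lambda>k. oc (snd k)) (oc y)"
    using assms r unfolding orbit_closure_map_Hausdorff_continuous_def by blast
  show "x \<in> oc y"
  proof (rule ccontr)
    assume "x \<notin> oc y"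
    then have "eventually (\<lambda>z. z \<notin> oc y) (nhds x)"
      using eventually_nhds_in_open[of "- oc y" x] by auto
    \<comment> \<open>This relation restricts only pairs with second entry \<open>x\<close>. It is
      an entourage because the complement of \<open>oc y\<close> is a neighbourhood of
      \<open>x\<close>, and its image of \<open>oc y\<close> omits \<open>x\<close>.\<close>
    then have "eventually (\<lambda>p. p \<in> {(z, a). a = x \<longrightarrow> z \<notin> oc y}) uniformity"
      unfolding eventually_nhds_uniformity
      by (rule eventually_mono[OF uniformity_sym]) auto
    then have "eventually (\<lambda>k. oc (snd k) \<subseteq> {(z, a). a = x \<longrightarrow> z \<notin> oc y} `` oc y) (net_filter r)"
      using lim unfolding tends_to_Hausdorff_def by (blast intro: eventually_mono)
    then obtain k where k: "k \<in> Field r" "oc (snd k) \<subseteq> {(z, a). a = x \<longrightarrow> z \<notin> oc y} `` oc y"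
      unfolding eventually_net_filter[OF r(1)] using directed_refl[OF r(1)] by blast
    obtain t where "snd k = act t x" using r(2) k(1) by (auto simp: orbit_def)
    then have "x \<in> oc (snd k)" using self_in_oc by (simp add: oc_act)
    with k(2) show False by blast
  qed
qed

text \<open>Since \<open>t = - k + (k + t)\<close>, syndeticity means that a compact set of times
  returns every point of the orbit to \<open>U\<close>.\<close>

lemma syndetic_returns:
  "syndetic {t. act t x \<in> U} \<longleftrightarrow> (\<exists>K. compact K \<and> (\<forall>t. \<exists>k\<in>K. act k (act t x) \<in> U))"
proof -
  have "UNIV = uminus ` K + {t. act t x \<in> U} \<longleftrightarrow> (\<forall>t. \<exists>k\<in>K. act k (act t x) \<in> U)" for K
  proof
    assume eq: "UNIV = uminus ` K + {t. act t x \<in> U}"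
    show "\<forall>t. \<exists>k\<in>K. act k (act t x) \<in> U"
    proof
      fix t
      have "t \<in> uminus ` K + {t. act t x \<in> U}" by (simp flip: eq)
      then obtain k a where "k \<in> K" "act a x \<in> U" "t = - k + a"
        by (auto simp: set_plus_def)
      moreover from this have "act k (act t x) = act a x"
        by (simp flip: act_add add.assoc)
      ultimately show "\<exists>k\<in>K. act k (act t x) \<in> U" by metis
    qed
  next
    assume R: "\<forall>t. \<exists>k\<in>K. act k (act t x) \<in> U"
    have "t \<in> uminus ` K + {t. act t x \<in> U}" for t
    proof -
      obtain k where k: "k \<in> K" "act k (act t x) \<in> U" using R by blast
      then have "- k + (k + t) \<in> uminus ` K + {t. act t x \<in> U}"
        by (intro set_plus_intro) (auto simp: act_add)
      then show ?thesis by simp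
    qed
    then show "UNIV = uminus ` K + {t. act t x \<in> U}" by blast
  qed
  then show ?thesis by (simp add: syndetic_def)
qed

text \<open>If \<open>x \<notin> oc y\<close>, take a compact open \<open>E\<close> around
  \<open>x\<close> missing \<open>oc y\<close>. No time of the compact return set \<open>K\<close>
  moves a point near \<open>y\<close> into \<open>E\<close>, yet the orbit of \<open>x\<close> comes
  near \<open>y\<close> and must return to \<open>E\<close> from there.\<close>

lemma almost_periodic_imp_symmetric:
  assumes "\<forall>x. almost_periodic act x"
  shows orbit_closures_symmetric
  unfolding orbit_closures_symmetric_def
proof (intro allI ballI, rule ccontr)
  fix x y assume y: "y \<in> oc x" and "x \<notin> oc y"
  then have "- oc y \<in> nbhds_of x" by (intro nbhds_of_open) auto
  then obtain E where E: "compact E" "open E" "x \<in> E" "E \<subseteq> - oc y"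
    by (rule compact_open_nbhd)
  have "syndetic {t. act t x \<in> E}"
    using assms nbhds_of_open[OF E(2,3)] by (simp add: almost_periodic_def)
  then obtain K where K: "compact K" "\<forall>t. \<exists>k\<in>K. act k (act t x) \<in> E"
    unfolding syndetic_returns by (elim exE conjE)
  have "eventually (\<lambda>z. \<forall>k\<in>K. act k z \<in> - E) (nhds y)"
  proof (rule eventually_compact_act[OF K(1)])
    show "open (- E)" using E(1) by (intro open_Compl compact_imp_closed)
    show "act k y \<in> - E" for k using E(4) act_in_oc[OF self_in_oc] by blast
  qed
  then obtain V where V: "open V" "y \<in> V" "\<forall>z\<in>V. \<forall>k\<in>K. act k z \<notin> E"
    unfolding eventually_nhds by blast
  obtain t where "act t x \<in> V" using closure_orbit_meets_open[OF y V(1,2)] .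
  with V(3) K(2) show False by blast
qed

text \<open>By symmetry every orbit starting in \<open>oc x\<close> enters \<open>U\<close>, so the
  open sets of points entering \<open>U\<close> at a given time cover the compact set
  \<open>oc x\<close>.\<close>

lemma symmetric_finite_returns:
  assumes orbit_closures_symmetric "open U" "x \<in> U"
  obtains T where "finite T" "\<forall>y\<in>oc x. \<exists>t\<in>T. act t y \<in> U"
proof -
  have "oc x \<subseteq> (\<Union>t\<in>UNIV. {y. act t y \<in> U})"
  proof
    fix y assume "y \<in> oc x"
    then have "x \<in> oc y" using assms(1) by (auto simp: orbit_closures_symmetric_def)
    then obtain t where "act t y \<in> U"
      using assms(2,3) by (rule closure_orbit_meets_open)
    then show "y \<in> (\<Union>t\<in>UNIV. {y. act t y \<in> U})" by blast
  qed
  with compact_oc open_point_set[OF assms(2)]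
  obtain T where "finite T" "oc x \<subseteq> (\<Union>t\<in>T. {y. act t y \<in> U})"
    by (rule compactE_image)
  then show ?thesis by (intro that[of T]) auto
qed

lemma symmetric_imp_almost_periodic:
  assumes orbit_closures_symmetric
  shows "almost_periodic act x"
  unfolding almost_periodic_def syndetic_returns
proof
  fix U assume "U \<in> nbhds_of x"
  then obtain E where E: "open E" "x \<in> E" "E \<subseteq> U"
    by (rule compact_open_nbhd)
  obtain T where T: "finite T" "\<forall>y\<in>oc x. \<exists>t\<in>T. act t y \<in> E"
    using assms E(1,2) by (rule symmetric_finite_returns)
  have "\<exists>k\<in>T. act k (act t x) \<in> U" for t
    using bspec[OF T(2) act_in_oc[OF self_in_oc]] E(3) by (meson subsetD)
  with finite_imp_compact[OF T(1)]
  show "\<exists>K. compact K \<and> (\<forall>t. \<exists>k\<in>K. act k (act t x) \<in> U)"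
    by (intro exI[of _ T] conjI allI)
qed

lemma locally_weakly_almost_periodic_imp_almost_periodic:
  assumes "locally_weakly_almost_periodic act"
  shows "almost_periodic act x"
  unfolding almost_periodic_def syndetic_returns
proof
  fix U assume "U \<in> nbhds_of x"
  \<comment> \<open>The section of this entourage at \<open>x\<close> is exactly \<open>U\<close>,
    so the condition at \<open>y = x\<close> is the return condition for \<open>U\<close>.\<close>
  then have "eventually (\<lambda>p. p \<in> {(a, z). a = x \<longrightarrow> z \<in> U}) uniformity"
    by (simp add: nbhds_of_def eventually_nhds_uniformity split_beta')
  from assms[unfolded locally_weakly_almost_periodic_def, rule_format, OF this, of x]
  obtain F V where F: "compact F" "V \<in> nbhds_of x" "\<forall>y\<in>V. \<forall>t.
      (\<lambda>f. act f (act t y)) ` F \<inter> {(a, z). a = x \<longrightarrow> z \<in> U} `` {y} \<noteq> {}"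
    by (elim exE conjE bexE)
  have "x \<in> V"
    using F(2) by (auto simp: nbhds_of_def dest: eventually_nhds_x_imp_x)
  have "\<exists>f\<in>F. act f (act t x) \<in> U" for t
    using F(3)[rule_format, OF \<open>x \<in> V\<close>, of t] by auto
  with F(1) show "\<exists>K. compact K \<and> (\<forall>t. \<exists>k\<in>K. act k (act t x) \<in> U)"
    by (intro exI[of _ F] conjI allI)
qed

section \<open>Upper semicontinuity of orbit closures\<close>

text \<open>By \<open>oc_subset_iff\<close> this is upper semicontinuity of the orbit closure map,
  tested on compact open sets.\<close>

definition open_cores :: bool where
  "open_cores \<longleftrightarrow> (\<forall>U. compact U \<longrightarrow> open U \<longrightarrow> open (invariant_core U))"

text \<open>A compact open set squeezed between \<open>oc x\<close> and \<open>W\<close> reduces an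
  arbitrary open \<open>W\<close> to the sets tested by \<open>open_cores\<close>.\<close>

lemma open_cores_eventually_subset:
  assumes open_cores "open W" "oc x \<subseteq> W"
  shows "eventually (\<lambda>y. oc y \<subseteq> W) (nhds x)"
proof -
  obtain U where U: "compact U" "open U" "oc x \<subseteq> U" "U \<subseteq> W"
    using compact_oc assms(2,3) by (rule compact_open_between)
  have core: "oc y \<subseteq> U \<longleftrightarrow> y \<in> invariant_core U" for y
    using U(1) by (intro oc_subset_iff compact_imp_closed)
  have "open (invariant_core U)"
    using assms(1) U(1,2) by (simp add: open_cores_def)
  then have "eventually (\<lambda>y. y \<in> invariant_core U) (nhds x)"
    using U(3) core by (intro eventually_nhds_in_open) auto
  then show ?thesis
    by eventually_elim (use core U(4) in blast)
qed

text \<open>Lower semicontinuity holds in every flow: a single time moving \<open>x\<close> into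
  \<open>W\<close> also moves all nearby points into \<open>W\<close>.\<close>

lemma eventually_oc_meets:
  assumes "z \<in> oc x" "open W" "z \<in> W"
  shows "eventually (\<lambda>y. oc y \<inter> W \<noteq> {}) (nhds x)"
proof -
  obtain t where "act t x \<in> W"
    using assms by (rule closure_orbit_meets_open)
  then have "eventually (\<lambda>y. y \<in> {y. act t y \<in> W}) (nhds x)"
    using open_point_set[OF assms(2)] by (intro eventually_nhds_in_open) auto
  then show ?thesis
    by eventually_elim (use act_in_oc[OF self_in_oc] in blast)
qed

section \<open>Consequences of open invariant cores\<close>

lemma open_cores_imp_closed:
  assumes open_cores
  shows "closed (orbit_closure_relation act)"
proof -
  have "open (- orbit_closure_relation act)"
  proof (subst open_subopen, intro ballI)
    fix p assume "p \<in> - orbit_closure_relation act"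
    then obtain x y where p: "p = (x, y)" "oc x \<subseteq> - {y}"
      by (cases p) (auto simp: orbit_closure_relation_def)
    \<comment> \<open>With \<open>V\<close> a neighbourhood of \<open>x\<close> on which orbit
      closures stay in \<open>U\<close>, the open box \<open>V \<times> - U\<close> separates the
      pair from the relation.\<close>
    obtain U where U: "compact U" "open U" "oc x \<subseteq> U" "U \<subseteq> - {y}"
      using compact_oc _ p(2) by (rule compact_open_between) auto
    obtain V where V: "open V" "x \<in> V" "\<And>z. z \<in> V \<Longrightarrow> oc z \<subseteq> U"
      using open_cores_eventually_subset[OF assms U(2,3)] unfolding eventually_nhds by blast
    have "open (V \<times> - U)"
      using V(1) U(1) by (intro open_Times open_Compl compact_imp_closed)
    moreover have "p \<in> V \<times> - U" using p(1) V(2) U(4) by auto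
    moreover have "V \<times> - U \<subseteq> - orbit_closure_relation act"
      using V(3) by (auto simp: orbit_closure_relation_def)
    ultimately show "\<exists>T. open T \<and> p \<in> T \<and> T \<subseteq> - orbit_closure_relation act" by blast
  qed
  then show ?thesis by (simp add: closed_def)
qed

text \<open>Lower semicontinuity puts \<open>oc x\<close> into the upper limit. A point
  \<open>z\<close> outside \<open>oc x\<close> is excluded because a compact open set around
  \<open>oc x\<close> missing \<open>z\<close> eventually contains the orbit closures, while its
  complement is a neighbourhood of \<open>z\<close>.\<close>

lemma open_cores_imp_upper_limit_continuous:
  assumes open_cores
  shows "orbit_closure_map_upper_limit_continuous act"
  unfolding orbit_closure_map_upper_limit_continuous_def tends_to_set_def
proof (intro allI impI conjI ballI closed_closure set_eqI iffI)
  fix r :: "('x set \<times> 'x) rel" and xs and x z :: 'x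
  assume r: "directed r" "(xs \<longlongrightarrow> x) (net_filter r)"
  have ev: "eventually (\<lambda>i. P (xs i)) (net_filter r)" if "eventually P (nhds x)" for P
    using r(2) that by (simp add: filterlim_iff)
  show "z \<in> upper_limit r (\<lambda>i. oc (xs i))" if "z \<in> oc x"
    unfolding mem_upper_limit_iff[OF r(1)]
    using net_filter_nontrivial[OF r(1)]
    by (intro allI impI eventually_frequently ev eventually_oc_meets[OF that])
  show "z \<in> oc x" if z: "z \<in> upper_limit r (\<lambda>i. oc (xs i))"
  proof (rule ccontr)
    assume "z \<notin> oc x"
    then have "open (- {z})" "oc x \<subseteq> - {z}" by auto
    with compact_oc obtain U where U: "compact U" "open U" "oc x \<subseteq> U" "U \<subseteq> - {z}"
      by (rule compact_open_between)
    have "open (- U)" "z \<in> - U"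
      using U(1,4) compact_imp_closed by auto
    then have "frequently (\<lambda>i. oc (xs i) \<inter> - U \<noteq> {}) (net_filter r)"
      using z by (simp add: mem_upper_limit_iff[OF r(1)])
    moreover have "eventually (\<lambda>i. oc (xs i) \<subseteq> U) (net_filter r)"
      by (intro ev open_cores_eventually_subset[OF assms] U)
    moreover have "oc y \<inter> - U = {} \<longleftrightarrow> oc y \<subseteq> U" for y by blast
    ultimately show False
      by (simp add: frequently_def)
  qed
qed

lemma open_cores_imp_Hausdorff_continuous:
  assumes open_cores
  shows "orbit_closure_map_Hausdorff_continuous act"
  unfolding orbit_closure_map_Hausdorff_continuous_def tends_to_Hausdorff_def
proof (intro allI impI conjI ballI closed_closure)
  fix r :: "('x set \<times> 'x) rel" and xs and x :: 'x and \<alpha> :: "('x \<times> 'x) set"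
  assume r: "directed r" "(xs \<longlongrightarrow> x) (net_filter r)" and \<alpha>: "eventually (\<lambda>p. p \<in> \<alpha>) uniformity"
  have upper: "eventually (\<lambda>y. oc y \<subseteq> \<alpha> `` oc x) (nhds x)"
  proof -
    have "oc x \<subseteq> interior (\<alpha> `` oc x)"
    proof
      fix z assume z: "z \<in> oc x"
      have "eventually (\<lambda>a. a \<in> \<alpha> `` {z}) (nhds z)"
        unfolding eventually_nhds_uniformity using \<alpha> by eventually_elim auto
      then show "z \<in> interior (\<alpha> `` oc x)"
        unfolding eventually_nhds interior_def using z by blast
    qed
    from open_cores_eventually_subset[OF assms open_interior this] show ?thesis
      by eventually_elim (use interior_subset in blast)
  qed
  have lower: "eventually (\<lambda>y. oc x \<subseteq> \<alpha> `` oc y) (nhds x)"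
  proof -
    obtain \<beta> where \<beta>: "eventually \<beta> uniformity" "\<And>a b c. \<beta> (a, b) \<Longrightarrow> \<beta> (b, c) \<Longrightarrow> (a, c) \<in> \<alpha>"
      using uniformity_transE[OF \<alpha>] by metis
    \<comment> \<open>Both orders of the pair are required so that two points of \<open>N z\<close>
      are \<alpha>-related through \<open>z\<close>. A finite cover of \<open>oc x\<close> by such
      sets leaves finitely many meeting conditions, which hold simultaneously near
      \<open>x\<close>.\<close>
    define N where "N z = interior {a. \<beta> (a, z) \<and> \<beta> (z, a)}" for z
    have "z \<in> N z" for z
    proof -
      have "eventually (\<lambda>a. \<beta> (a, z) \<and> \<beta> (z, a)) (nhds z)"
        unfolding eventually_nhds_uniformity
        using \<beta>(1) uniformity_sym[OF \<beta>(1)] by eventually_elim auto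
      then show ?thesis
        unfolding N_def eventually_nhds interior_def by blast
    qed
    then have "oc x \<subseteq> (\<Union>z\<in>oc x. N z)" by blast
    moreover have "open (N z)" for z by (simp add: N_def)
    ultimately obtain Z where Z: "Z \<subseteq> oc x" "finite Z" "oc x \<subseteq> (\<Union>z\<in>Z. N z)"
      using compactE_image[OF compact_oc, of "oc x" N x] by metis
    have "eventually (\<lambda>y. \<forall>z\<in>Z. oc y \<inter> N z \<noteq> {}) (nhds x)"
      using Z(1) \<open>\<And>z. z \<in> N z\<close> \<open>\<And>z. open (N z)\<close>
      by (intro eventually_ball_finite[OF Z(2)] ballI eventually_oc_meets) auto
    then show ?thesis
    proof eventually_elim
      case (elim y)
      show ?case
      proof
        fix a assume "a \<in> oc x"
        then obtain z where z: "z \<in> Z" "a \<in> N z" using Z(3) by blast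
        then obtain b where b: "b \<in> oc y" "b \<in> N z" using elim by blast
        have "\<beta> (b, z)" "\<beta> (z, a)"
          using z(2) b(2) interior_subset unfolding N_def by blast+
        with \<beta>(2) b(1) show "a \<in> \<alpha> `` oc y" by blast
      qed
    qed
  qed
  from upper lower have "eventually (\<lambda>y. oc y \<subseteq> \<alpha> `` oc x \<and> oc x \<subseteq> \<alpha> `` oc y) (nhds x)"
    by (rule eventually_conj)
  then show "eventually (\<lambda>i. oc (xs i) \<subseteq> \<alpha> `` oc x \<and> oc x \<subseteq> \<alpha> `` oc (xs i)) (net_filter r)"
    using r(2) by (rule eventually_compose_filterlim)
qed

lemma open_cores_imp_locally_weakly_almost_periodic:
  assumes open_cores
  shows "locally_weakly_almost_periodic act"
  unfolding locally_weakly_almost_periodic_def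
proof (intro allI impI)
  fix \<alpha> :: "('x \<times> 'x) set" and x assume \<alpha>: "eventually (\<lambda>p. p \<in> \<alpha>) uniformity"
  obtain \<beta> where \<beta>: "eventually \<beta> uniformity" "\<And>a b c. \<beta> (a, b) \<Longrightarrow> \<beta> (b, c) \<Longrightarrow> (a, c) \<in> \<alpha>"
    using uniformity_transE[OF \<alpha>] by metis
  \<comment> \<open>Any two points of \<open>W\<close> are \<alpha>-related through
    \<open>x\<close>, so returning to \<open>W\<close> means returning \<alpha>-close to every
    \<open>y \<in> W\<close>.\<close>
  define W where "W = interior {a. \<beta> (a, x) \<and> \<beta> (x, a)}"
  have "eventually (\<lambda>a. \<beta> (a, x) \<and> \<beta> (x, a)) (nhds x)"
    unfolding eventually_nhds_uniformity
    using \<beta>(1) uniformity_sym[OF \<beta>(1)] by eventually_elim auto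
  then have W: "open W" "x \<in> W"
    unfolding W_def eventually_nhds interior_def by blast+
  have W\<alpha>: "(a, b) \<in> \<alpha>" if "a \<in> W" "b \<in> W" for a b
    using that interior_subset \<beta>(2) unfolding W_def by blast
  have orbit_closures_symmetric
    using assms open_cores_imp_closed closed_imp_symmetric by simp
  then obtain T where T: "finite T" "\<forall>y\<in>oc x. \<exists>t\<in>T. act t y \<in> W"
    using W by (rule symmetric_finite_returns)
  \<comment> \<open>The finite set \<open>T\<close> returns every point of \<open>O'\<close> to
    \<open>W\<close>. Orbit closures near \<open>x\<close> stay inside \<open>O'\<close>, so the
    same \<open>T\<close> serves all of them.\<close>
  define O' where "O' = (\<Union>t\<in>T. {y. act t y \<in> W})"
  have "open O'" "oc x \<subseteq> O'"
    unfolding O'_def using open_point_set[OF W(1)] T(2) by auto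
  then have "eventually (\<lambda>y. oc y \<subseteq> O' \<and> y \<in> W) (nhds x)"
    using open_cores_eventually_subset[OF assms] W by (intro eventually_conj eventually_nhds_in_open)
  then have "{y. oc y \<subseteq> O' \<and> y \<in> W} \<in> nbhds_of x"
    by (simp add: nbhds_of_def)
  moreover have "(\<lambda>f. act f (act t y)) ` T \<inter> \<alpha> `` {y} \<noteq> {}" if "oc y \<subseteq> O' \<and> y \<in> W" for y t
  proof -
    have "act t y \<in> O'" using that act_in_oc[OF self_in_oc] by blast
    then obtain f where "f \<in> T" "act f (act t y) \<in> W" by (auto simp: O'_def)
    then show ?thesis using W\<alpha> that by blast
  qed
  ultimately have "\<exists>V\<in>nbhds_of x. \<forall>y\<in>V. \<forall>t. (\<lambda>f. act f (act t y)) ` T \<inter> \<alpha> `` {y} \<noteq> {}"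
    by (intro bexI[of _ "{y. oc y \<subseteq> O' \<and> y \<in> W}"]) simp_all
  with finite_imp_compact[OF T(1)]
  show "\<exists>F. compact F \<and> (\<exists>V\<in>nbhds_of x. \<forall>y\<in>V. \<forall>t. (\<lambda>f. act f (act t y)) ` F \<inter> \<alpha> `` {y} \<noteq> {})"
    by (intro exI[of _ T] conjI)
qed

end

section \<open>Recurrence\<close>

locale compactly_generated_flow = zero_dim_flow act + compactly_generated \<Gamma>
  for act :: "'g::{group_add, topological_monoid_add, t2_space} \<Rightarrow> 'x::{uniform_space, t2_space} \<Rightarrow> 'x"
    and \<Gamma> :: "'g set"
begin

text \<open>The return times of bounded length lie in one compact power of \<open>\<Gamma>\<close>,
  so they cluster at an element of the cone.\<close>

lemma recurrent_II_imp_recurrent_I: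
  assumes "recurrent_II act \<Gamma> x"
  shows "recurrent_I act \<Gamma> x"
  unfolding recurrent_I_def
proof (intro allI impI ballI)
  fix C U assume "gamma_cone \<Gamma> C" "U \<in> nbhds_of x"
  then obtain r :: "('g set \<times> 'g) rel" and g where r: "directed r" "\<forall>i\<in>Field r. g i \<noteq> 0"
      "filterlim (\<lambda>i. word_len \<Gamma> (g i)) at_top (net_filter r)"
      "C = upper_limit r (\<lambda>i. K_set \<Gamma> (g i))"
    unfolding gamma_cone_def tends_to_set_def by metis
  \<comment> \<open>A compact open \<open>E\<close> makes the set of return times closed, so the
    cluster time is still a return time.\<close>
  obtain E where E: "compact E" "open E" "x \<in> E" "E \<subseteq> U"
    using \<open>U \<in> nbhds_of x\<close> by (rule compact_open_nbhd)
  obtain n and s :: "('g set \<times> 'g) rel" and h c where s: "subnet r s h"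
    "\<forall>j\<in>Field s. c j \<in> K_set \<Gamma> (g (h j)) \<and> act (c j) x \<in> E \<and> word_len \<Gamma> (c j) \<le> n"
    using recurrent_II_D[OF assms nbhds_of_open[OF E(2,3)] r(1) bspec[OF r(2)] r(3)] by metis
  have "frequently (\<lambda>i. \<exists>d. d \<in> K_set \<Gamma> (g i) \<and> act d x \<in> E \<and> word_len \<Gamma> d \<le> n) (net_filter r)"
    using r(1) s(1) bspec[OF s(2)] by (rule frequently_of_subnet)
  then have "frequently (\<lambda>i. K_set \<Gamma> (g i) \<inter> set_pow \<Gamma> n \<inter> {d. act d x \<in> E} \<noteq> {}) (net_filter r)"
    by (rule frequently_elim1) (auto simp: mem_set_pow_iff)
  moreover have "closed {d. act d x \<in> E}"
    using open_time_set[of "- E" x] compact_imp_closed[OF E(1)] by (simp add: closed_def Collect_neg_eq)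
  ultimately have "C \<inter> {d. act d x \<in> E} \<noteq> {}"
    unfolding r(4) by (intro upper_limit_inter_compact[OF r(1) compact_set_pow[OF compact_Gamma]])
  with E(4) show "(\<lambda>c. act c x) ` C \<inter> U \<noteq> {}" by blast
qed

text \<open>Split a long word as \<open>k = a + h\<close> with a short tail \<open>h\<close> and let
  some \<open>t \<in> T\<close> return \<open>act h x\<close> to \<open>E\<close>. The time
  \<open>t + h\<close> is short, and it equals \<open>(t + - a) + k\<close> with
  \<open>t + - a\<close> short enough for \<open>K_set\<close>.\<close>

lemma symmetric_imp_recurrent_II:
  assumes orbit_closures_symmetric
  shows "recurrent_II act \<Gamma> x"
proof (rule recurrent_II_I)
  fix U and r :: "('g set \<times> 'g) rel" and g
  assume "U \<in> nbhds_of x" and r: "directed r" "filterlim (\<lambda>i. word_len \<Gamma> (g i)) at_top (net_filter r)"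
  obtain E where E: "compact E" "open E" "x \<in> E" "E \<subseteq> U"
    using \<open>U \<in> nbhds_of x\<close> by (rule compact_open_nbhd)
  obtain T where T: "finite T" "\<forall>y\<in>oc x. \<exists>t\<in>T. act t y \<in> E"
    using assms E(2,3) by (rule symmetric_finite_returns)
  \<comment> \<open>The sum bounds every length occurring in the finite set
    \<open>T\<close>.\<close>
  define m where "m = (\<Sum>t\<in>T. word_len \<Gamma> t)"
  have Tm: "T \<subseteq> set_pow \<Gamma> m"
    unfolding m_def using T(1) by (auto simp: mem_set_pow_iff intro: member_le_sum)
  have *: "\<exists>c. c \<in> K_set \<Gamma> k \<and> act c x \<in> U \<and> word_len \<Gamma> c \<le> m + Suc m"
    if "word_len \<Gamma> k \<ge> Suc m" for k
  proof -
    \<comment> \<open>The tail gets \<open>Suc m\<close> letters rather than \<open>m\<close>, so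
      that \<open>m + p\<close> is exactly the exponent \<open>word_len \<Gamma> k - 1\<close> in
      \<open>K_set\<close>.\<close>
    define p where "p = word_len \<Gamma> k - Suc m"
    have p: "word_len \<Gamma> k = p + Suc m" using that by (simp add: p_def)
    then have "k \<in> set_pow \<Gamma> p + set_pow \<Gamma> (Suc m)"
      using mem_set_pow_word_len[of k] by (simp only: set_pow_add)
    then obtain a h where ah: "k = a + h" "a \<in> set_pow \<Gamma> p" "h \<in> set_pow \<Gamma> (Suc m)"
      by (rule set_plus_elim)
    obtain t where t: "t \<in> T" "act t (act h x) \<in> E"
      using bspec[OF T(2) act_in_oc[OF self_in_oc]] by blast
    have "t + - a \<in> set_pow \<Gamma> (m + p)"
      unfolding set_pow_add using t(1) Tm uminus_mem_set_pow[OF ah(2)] by (intro set_plus_intro) auto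
    then have "(t + - a) + k \<in> K_set \<Gamma> k"
      unfolding K_set_def p by (intro imageI) (simp add: add.commute)
    moreover have "(t + - a) + k = t + h"
      unfolding ah(1) add.assoc by (simp only: minus_add_cancel)
    moreover have "t + h \<in> set_pow \<Gamma> (m + Suc m)"
      unfolding set_pow_add using t(1) Tm ah(3) by (intro set_plus_intro) auto
    ultimately show ?thesis
      using t(2) E(4) unfolding mem_set_pow_iff by (intro exI[of _ "t + h"]) (auto simp: act_add)
  qed
  have "eventually (\<lambda>i. Suc m \<le> word_len \<Gamma> (g i)) (net_filter r)"
    using r(2) by (simp add: filterlim_at_top)
  then have "eventually (\<lambda>i. \<exists>c. c \<in> K_set \<Gamma> (g i) \<and> act c x \<in> U \<and> word_len \<Gamma> c \<le> m + Suc m) (net_filter r)"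
    by eventually_elim (rule *)
  then have "frequently (\<lambda>i. \<exists>c. c \<in> K_set \<Gamma> (g i) \<and> act c x \<in> U \<and> word_len \<Gamma> c \<le> m + Suc m) (net_filter r)"
    using net_filter_nontrivial[OF r(1)] by (intro eventually_frequently)
  from subnet_of_frequently[OF r(1) this]
  show "\<exists>n\<ge>1. \<exists>(s :: ('g set \<times> 'g) rel) h c. subnet r s h \<and>
      (\<forall>j\<in>Field s. c j \<in> K_set \<Gamma> (g (h j)) \<and> act (c j) x \<in> U \<and> word_len \<Gamma> (c j) \<le> n)"
    by (intro exI[of _ "m + Suc m"] conjI) auto
qed

text \<open>Take \<open>h\<close> of least length among the times moving \<open>z\<close> out of
  \<open>U\<close>. Strictly shorter words keep \<open>z\<close> in \<open>U\<close>, and times in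
  \<open>K_set \<Gamma> (- h)\<close> applied to the exit point undo \<open>h\<close> and then apply
  such a shorter word to \<open>z\<close>.\<close>

lemma shortest_escape:
  assumes "z \<in> U" "z \<notin> invariant_core U"
  obtains h where "h \<noteq> 0" "act h z \<notin> U" "act h z \<in> (\<lambda>(t, y). act t y) ` (\<Gamma> \<times> U)"
    "\<And>c. c \<in> K_set \<Gamma> (- h) \<Longrightarrow> act c (act h z) \<in> U"
proof -
  obtain h where h: "act h z \<notin> U" "\<And>k. act k z \<notin> U \<Longrightarrow> word_len \<Gamma> h \<le> word_len \<Gamma> k"
    using assms(2) ex_has_least_nat[of "\<lambda>h. act h z \<notin> U" _ "word_len \<Gamma>"]
    unfolding invariant_core_def by blast
  have "h \<noteq> 0" using h(1) assms(1) act_0 by auto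
  then have "word_len \<Gamma> h \<noteq> 0"
    using mem_set_pow_word_len[of h] by (metis set_pow.simps(1) singletonD)
  \<comment> \<open>Negation preserves length, so \<open>p\<close> is also the exponent in
    \<open>K_set \<Gamma> (- h)\<close>.\<close>
  then obtain p where p: "word_len \<Gamma> h = Suc p"
    by (metis not0_implies_Suc)
  have short: "act k z \<in> U" if "k \<in> set_pow \<Gamma> p" for k
    using that h(2)[of k] p by (auto simp: mem_set_pow_iff)
  show ?thesis
  proof (rule that)
    show "h \<noteq> 0" "act h z \<notin> U" by fact+
    \<comment> \<open>The split is at the leftmost letter, which acts last: the point is still in
      \<open>U\<close> just before it.\<close>
    have "h \<in> set_pow \<Gamma> 1 + set_pow \<Gamma> p"
      using mem_set_pow_word_len[of h] p by (metis plus_1_eq_Suc set_pow_add)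
    then obtain a k where ak: "h = a + k" "a \<in> set_pow \<Gamma> 1" "k \<in> set_pow \<Gamma> p"
      by (rule set_plus_elim)
    then have "a \<in> \<Gamma>" by (simp flip: set_zero)
    then have "(a, act k z) \<in> \<Gamma> \<times> U" using short[OF ak(3)] by simp
    then show "act h z \<in> (\<lambda>(t, y). act t y) ` (\<Gamma> \<times> U)"
      using ak(1) act_add by (intro image_eqI[of _ _ "(a, act k z)"]) auto
    fix c assume "c \<in> K_set \<Gamma> (- h)"
    then obtain k where "k \<in> set_pow \<Gamma> p" "c = k + - h"
      unfolding K_set_def word_len_uminus p by auto
    then show "act c (act h z) \<in> U"
      using short act_minus by (simp add: act_add del: add_uminus_conv_diff)
  qed
qed

section \<open>From type I recurrence to open invariant cores\<close>

lemma recurrent_I_imp_open_cores: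
  assumes "\<forall>x. recurrent_I act \<Gamma> x"
  shows open_cores
  unfolding open_cores_def
proof (intro allI impI)
  fix U :: "'x set" assume U: "compact U" "open U"
  have "eventually (\<lambda>z. z \<in> invariant_core U) (nhds x)" if x: "x \<in> invariant_core U" for x
  proof (rule ccontr)
    assume nev: "\<not> ?thesis"
    \<comment> \<open>These are the points of \<open>U\<close> that leave \<open>U\<close> at some
      time. If the claim fails, they accumulate at \<open>x\<close>, which makes \<open>F\<close>
      proper.\<close>
    define S where "S = U - invariant_core U"
    define F where "F = inf (nhds x) (principal S)"
    have xU: "act t x \<in> U" for t using x by (simp add: invariant_core_def)
    then have "x \<in> U" by (metis act_0)
    then have evU: "eventually (\<lambda>z. z \<in> U) (nhds x)"
      using U(2) by (intro eventually_nhds_in_open)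
    have "F \<noteq> bot"
    proof
      assume "F = bot"
      then have "eventually (\<lambda>z. z \<notin> S) (nhds x)"
        by (simp add: F_def trivial_limit_def eventually_inf_principal)
      with evU have "eventually (\<lambda>z. z \<in> invariant_core U) (nhds x)"
        by eventually_elim (simp add: S_def)
      with nev show False by simp
    qed
    have FS: "eventually (\<lambda>z. z \<in> S) F"
      by (simp add: F_def eventually_inf_principal)
    have "\<forall>z\<in>S. \<exists>h. h \<noteq> 0 \<and> act h z \<notin> U \<and> act h z \<in> (\<lambda>(t, y). act t y) ` (\<Gamma> \<times> U) \<and>
        (\<forall>c\<in>K_set \<Gamma> (- h). act c (act h z) \<in> U)"
      unfolding S_def using shortest_escape by (metis DiffE)
    then obtain g where g: "\<And>z. z \<in> S \<Longrightarrow> g z \<noteq> 0" "\<And>z. z \<in> S \<Longrightarrow> act (g z) z \<notin> U"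
        "\<And>z. z \<in> S \<Longrightarrow> act (g z) z \<in> (\<lambda>(t, y). act t y) ` (\<Gamma> \<times> U)"
        "\<And>z c. z \<in> S \<Longrightarrow> c \<in> K_set \<Gamma> (- g z) \<Longrightarrow> act c (act (g z) z) \<in> U"
      by (metis (no_types, lifting))
    \<comment> \<open>Removing the open set \<open>U\<close> preserves compactness and keeps every
      cluster point of the exit points outside \<open>U\<close>.\<close>
    define L where "L = (\<lambda>(t, y). act t y) ` (\<Gamma> \<times> U) - U"
    have "continuous_on (\<Gamma> \<times> U) (\<lambda>(t, y). act t y)"
      by (auto simp: split_beta' intro!: continuous_on_act continuous_intros)
    then have "compact L"
      unfolding L_def using compact_Gamma U
      by (intro compact_diff compact_continuous_image compact_Times)
    moreover have "eventually (\<lambda>z. act (g z) z \<in> L) F"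
      using FS by eventually_elim (use g(2,3) in \<open>simp add: L_def\<close>)
    ultimately obtain y where y: "y \<in> L" "inf F (filtercomap (\<lambda>z. act (g z) z) (nhds y)) \<noteq> bot"
      using \<open>F \<noteq> bot\<close> by (rule_tac compact_cluster_point)
    \<comment> \<open>Along this refinement the starting points tend to \<open>x\<close> and the
      exit points tend to \<open>y\<close>.\<close>
    define F' where "F' = inf F (filtercomap (\<lambda>z. act (g z) z) (nhds y))"
    have le: "F' \<le> F" "F' \<le> filtercomap (\<lambda>z. act (g z) z) (nhds y)"
      by (simp_all add: F'_def)
    have "eventually (\<lambda>z. z \<in> S) F'"
      using FS le(1) by (rule filter_leD[rotated])
    with y(2) obtain r :: "('x set \<times> 'x) rel" where r: "directed r" "snd ` Field r \<subseteq> S"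
        "filtermap snd (net_filter r) = F'"
      unfolding F'_def by (rule net_of_filter)
    have ev: "eventually (\<lambda>k. P (snd k)) (net_filter r)" if "eventually P F'" for P
      using that by (simp flip: r(3) add: eventually_filtermap)
    have long: "filterlim (\<lambda>k. word_len \<Gamma> (- g (snd k))) at_top (net_filter r)"
      unfolding filterlim_at_top
    proof
      fix n
      \<comment> \<open>All words in the compact set \<open>set_pow \<Gamma> n\<close> keep
        \<open>x\<close> in \<open>U\<close>, hence also the points near \<open>x\<close>; an escape
        from there takes a longer word.\<close>
      have "eventually (\<lambda>z. \<forall>t\<in>set_pow \<Gamma> n. act t z \<in> U) (nhds x)"
        using xU U(2) by (intro eventually_compact_act compact_set_pow compact_Gamma)
      then have "eventually (\<lambda>z. \<forall>t\<in>set_pow \<Gamma> n. act t z \<in> U) F"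
        unfolding F_def by (simp add: eventually_inf_principal eventually_mono)
      then have "eventually (\<lambda>z. n \<le> word_len \<Gamma> (g z)) F"
        using FS
      proof eventually_elim
        case (elim z)
        then have "g z \<notin> set_pow \<Gamma> n" using g(2) by blast
        then show ?case by (simp add: mem_set_pow_iff)
      qed
      then show "eventually (\<lambda>k. n \<le> word_len \<Gamma> (- g (snd k))) (net_filter r)"
        unfolding word_len_uminus by (intro ev filter_leD[OF le(1)])
    qed
    define C where "C = upper_limit r (\<lambda>k. K_set \<Gamma> (- g (snd k)))"
    have "gamma_cone \<Gamma> C"
    \<comment> \<open>The net is indexed over the space and its lengths need not be monotone;
      \<open>gamma_coneI\<close> supplies the index type and the monotonicity that a cone
      requires.\<close>
    proof (rule gamma_coneI[OF r(1) _ long])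
      show "- g (snd k) \<noteq> 0" if "k \<in> Field r" for k
        using g(1)[of "snd k"] r(2) that by auto
      show "tends_to_set r (\<lambda>k. K_set \<Gamma> (- g (snd k))) C"
        unfolding tends_to_set_def C_def using closed_K_set closed_upper_limit[OF r(1)] by simp
    qed
    \<comment> \<open>As \<open>U\<close> is closed, \<open>- U\<close> is a neighbourhood of
      \<open>y\<close>, and recurrence of \<open>y\<close> gives a cone element keeping
      \<open>y\<close> outside \<open>U\<close>.\<close>
    moreover have "y \<in> - U" "open (- U)"
      using y(1) U(1) by (auto simp: L_def intro: compact_imp_closed)
    ultimately obtain c where c: "c \<in> C" "act c y \<in> - U"
      using assms nbhds_of_open[of "- U" y] unfolding recurrent_I_def by blast
    have "(c, y) \<in> {(t, z). act t z \<in> - U}" using c(2) by simp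
    with open_act_vimage[OF \<open>open (- U)\<close>] obtain W V where W: "open W" "open V" "(c, y) \<in> W \<times> V"
        "W \<times> V \<subseteq> {(t, z). act t z \<in> - U}"
      by (rule open_prod_elim)
    then have WV: "open W" "open V" "c \<in> W" "y \<in> V" "W \<times> V \<subseteq> {(t, z). act t z \<in> - U}"
      by simp_all
    \<comment> \<open>Times in \<open>W\<close> keep exit points in \<open>V\<close> outside
      \<open>U\<close>, but times in \<open>K_set\<close> bring them back into \<open>U\<close>. So
      \<open>K_set\<close> eventually misses \<open>W\<close>, although \<open>c\<close> lies in the
      upper limit.\<close>
    have "eventually (\<lambda>z. act (g z) z \<in> V) (filtercomap (\<lambda>z. act (g z) z) (nhds y))"
      using eventually_nhds_in_open[OF WV(2,4)] by (rule eventually_filtercomapI)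
    then have "eventually (\<lambda>k. act (g (snd k)) (snd k) \<in> V) (net_filter r)"
      by (intro ev filter_leD[OF le(2)])
    moreover have "eventually (\<lambda>k. snd k \<in> S) (net_filter r)"
      by (intro ev) fact
    ultimately have "eventually (\<lambda>k. \<not> K_set \<Gamma> (- g (snd k)) \<inter> W \<noteq> {}) (net_filter r)"
    proof eventually_elim
      case (elim k)
      have False if d: "d \<in> K_set \<Gamma> (- g (snd k))" "d \<in> W" for d
      proof -
        have "(d, act (g (snd k)) (snd k)) \<in> {(t, z). act t z \<in> - U}"
          using WV(5) d(2) elim(1) by blast
        with g(4)[OF elim(2) d(1)] show False by simp
      qed
      then show ?case by blast
    qed
    moreover have "frequently (\<lambda>k. K_set \<Gamma> (- g (snd k)) \<inter> W \<noteq> {}) (net_filter r)"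
      using c(1) WV(1,3) by (simp add: C_def mem_upper_limit_iff[OF r(1)])
    ultimately show False
      unfolding frequently_def by (rule notE[rotated])
  qed
  then show "open (invariant_core U)"
    by (subst open_subopen) (simp add: eventually_nhds subset_eq)
qed

end

theorem theoremA:
  fixes act :: "'g::{group_add, topological_monoid_add, t2_space} \<Rightarrow> 'x::{uniform_space, t2_space} \<Rightarrow> 'x"
    and \<Gamma> :: "'g set"
  assumes "flow act"
    and "compact_generating_set \<Gamma>"
    and "zero_dimensional TYPE('x)"
  shows "((\<forall>x. recurrent_I act \<Gamma> x) \<longleftrightarrow> (\<forall>x. almost_periodic act x)) \<and>
    ((\<forall>x. recurrent_II act \<Gamma> x) \<longleftrightarrow> (\<forall>x. almost_periodic act x)) \<and>
    ((\<forall>x. almost_periodic act x) \<longleftrightarrow> (\<exists>\<M>. (\<forall>K\<in>\<M>. minimal_set act K) \<and> \<Union>\<M> = UNIV)) \<and>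
    ((\<forall>x. almost_periodic act x) \<longleftrightarrow> closed (orbit_closure_relation act)) \<and>
    ((\<forall>x. almost_periodic act x) \<longleftrightarrow> orbit_closure_map_upper_limit_continuous act) \<and>
    ((\<forall>x. almost_periodic act x) \<longleftrightarrow> orbit_closure_map_Hausdorff_continuous act) \<and>
    ((\<forall>x. almost_periodic act x) \<longleftrightarrow> locally_weakly_almost_periodic act)"
proof -
  interpret compactly_generated_flow act \<Gamma>
    using assms by unfold_locales
  \<comment> \<open>Each property is compared with symmetry of orbit closures, and the stated
    equivalences follow by rewriting with these comparisons.\<close>
  have ap: "(\<forall>x. almost_periodic act x) \<longleftrightarrow> orbit_closures_symmetric"
    using almost_periodic_imp_symmetric symmetric_imp_almost_periodic by iprover
  have cores: "orbit_closures_symmetric \<longleftrightarrow> open_cores"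
    using open_cores_imp_closed closed_imp_symmetric symmetric_imp_recurrent_II
      recurrent_II_imp_recurrent_I recurrent_I_imp_open_cores by iprover
  have I: "(\<forall>x. recurrent_I act \<Gamma> x) \<longleftrightarrow> orbit_closures_symmetric"
    using cores recurrent_I_imp_open_cores symmetric_imp_recurrent_II recurrent_II_imp_recurrent_I
    by iprover
  have II: "(\<forall>x. recurrent_II act \<Gamma> x) \<longleftrightarrow> orbit_closures_symmetric"
    using I symmetric_imp_recurrent_II recurrent_II_imp_recurrent_I by iprover
  have "orbit_closures_symmetric \<longleftrightarrow> closed (orbit_closure_relation act)"
    using cores open_cores_imp_closed closed_imp_symmetric by iprover
  moreover have "orbit_closures_symmetric \<longleftrightarrow> orbit_closure_map_upper_limit_continuous act"
    using cores open_cores_imp_upper_limit_continuous upper_limit_continuous_imp_symmetric by iprover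
  moreover have "orbit_closures_symmetric \<longleftrightarrow> orbit_closure_map_Hausdorff_continuous act"
    using cores open_cores_imp_Hausdorff_continuous Hausdorff_continuous_imp_symmetric by iprover
  moreover have "orbit_closures_symmetric \<longleftrightarrow> locally_weakly_almost_periodic act"
    using cores ap open_cores_imp_locally_weakly_almost_periodic
      locally_weakly_almost_periodic_imp_almost_periodic by iprover
  ultimately show ?thesis
    unfolding ap I II using symmetric_iff_union_minimal by (intro conjI refl)
qed

end
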